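(* (Hard-thresholding with conservative tuning) Suppose that for given $i\ge1$ satisfying $i\le k=k(n)$ for large enough $n$ we have $\xi_{i,n}\eta_{i,n}\to0$ and $n^{1/2}\eta_{i,n}\to e_i$ where $0\le e_i<\infty$. Set the scaling factor $\alpha_{i,n}=n^{1/2}/\xi_{i,n}$. Suppose that the true parameters $\theta^{(n)}=(\theta_{1,n},\dots,\theta_{k_n,n})\in\mathbb{R}^{k_n}$ (with $k_n=k(n)$) and $\sigma_n\in(0,\infty)$ satisfy $n^{1/2}\theta_{i,n}/(\sigma_n\xi_{i,n})\to\nu_i\in\bar{\mathbb{R}}$. Let $H_n$ denote the cdf of $\sigma_n^{-1}\alpha_{i,n}(\tilde\theta_{H,i}-\theta_{i,n})$ under $P_{n,\theta^{(n)},\sigma_n}$. (a) If $n-k$ is eventually constant equal to $m$, say, then $H_n$ converges weakly to the distribution with cdf $$\int_0^\infty\left\{\Phi(x)\mathbf{1}(|x+\nu_i|>se_i)+\Phi(-\nu_i+se_i)\mathbf{1}(0\le x+\nu_i\le se_i)+\Phi(-\nu_i-se_i)\mathbf{1}(-se_i\le x+\nu_i<0)\right\}\rho_m(s)\,ds,$$ the corresponding measure being $$\int_0^\infty\left\{\Phi(-\nu_i+se_i)-\Phi(-\nu_i-se_i)\right\}\rho_m(s)\,ds\;d\delta_{-\nu_i}(x)+\phi(x)\int_0^\infty\mathbf{1}(|x+\nu_i|>se_i)\rho_m(s)\,ds\,dx.$$ (The distribution reduces to a standard normal distribution in case $|\nu_i|=\infty$ or $e_i=0$.) (b) If $n-k\to\infty$,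 then $H_n$ converges weakly to the distribution with cdf $$\Phi(x)\mathbf{1}(|x+\nu_i|>e_i)+\Phi(-\nu_i+e_i)\mathbf{1}(0\le x+\nu_i\le e_i)+\Phi(-\nu_i-e_i)\mathbf{1}(-e_i\le x+\nu_i<0),$$ the corresponding measure being $$\left\{\Phi(-\nu_i+e_i)-\Phi(-\nu_i-e_i)\right\}d\delta_{-\nu_i}(x)+\phi(x)\mathbf{1}(|x+\nu_i|>e_i)\,dx$$ (which reduces to a standard normal distribution in case $|\nu_i|=\infty$ or $e_i=0$).
   Context: For each sample size $n$ consider the linear regression model $Y=X\theta+u$, where $X$ is a nonstochastic $n\times k$ matrix of rank $k\ge1$ with $k<n$, $\theta\in\mathbb{R}^k$, $u\sim N(0,\sigma^2I_n)$, $0<\sigma<\infty$. The number $k=k(n)$, the entries of $X,Y,u$ and the underlying probability space may depend on $n$. $P_{n,\theta,\sigma}$ denotes probability under parameters $\theta,\sigma$. $X'$ is the transpose of $X$. $\xi_{i,n}$ is the nonnegative square root of the $i$-th diagonal element of $(X'X/n)^{-1}$. $\hat\theta_{LS}=(X'X)^{-1}X'Y$ with $i$-th component $\hat\theta_{LS,i}$, and $\hat\sigma^2=(n-k)^{-1}(Y-X\hat\theta_{LS})'(Y-X\hat\theta_{LS})$, $\hat\sigma\ge0$. The tuning parameters $\eta_{i,n}$ are positive real numbers. The hard-thresholding estimator is $\tilde\theta_{H,i}=\hat\theta_{LS,i}\mathbf{1}(|\hat\theta_{LS,i}|>\hat\sigma\xi_{i,n}\eta_{i,n})$. Standing assumption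 for all asymptotics: $\sup_n\xi_{j,n}^2/n<\infty$ for every fixed $j\ge1$ satisfying $j\le k(n)$ for large enough $n$. $\Phi,\phi$ are the standard normal cdf and pdf, $\Phi(\infty)=1$, $\Phi(-\infty)=0$; $\bar{\mathbb{R}}=\mathbb{R}\cup\{-\infty,\infty\}$; $\delta_z$ is pointmass at $z$; if $|\nu_i|=\infty$ then $x+\nu_i=\nu_i$ and the pointmass term, having zero weight, is absent. $\rho_m$ is the density of $m^{-1/2}$ times the square root of a chi-square random variable with $m$ degrees of freedom, with $\rho_m(s)=0$ for $s<0$. *)

theory Defs
  imports
    "HOL-Probability.Probability"
    "Jordan_Normal_Form.Gauss_Jordan_Elimination"
    "Jordan_Normal_Form.DL_Rank"
begin

section \<open>Least squares and hard-thresholding\<close>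

text \<open>
  The design matrix is a \<open>real mat\<close> with \<open>n = dim_row X\<close> and \<open>k = dim_col X\<close>. Rows, columns
  and components are numbered from 0, so component \<open>i\<close> exists iff \<open>i < k\<close>.
  Under full column rank the matrices inverted below are invertible, so \<open>the\<close> is never
  applied to \<open>None\<close>.
\<close>

definition ls_est :: "real mat \<Rightarrow> real Matrix.vec \<Rightarrow> real Matrix.vec" where
  "ls_est X y =
     the (mat_inverse (transpose_mat X * X)) *\<^sub>v (transpose_mat X *\<^sub>v y)"

definition ls_resid :: "real mat \<Rightarrow> real Matrix.vec \<Rightarrow> real Matrix.vec" where
  "ls_resid X y = y - X *\<^sub>v ls_est X y"

definition sigma_hat :: "real mat \<Rightarrow> real Matrix.vec \<Rightarrow> real" where
  "sigma_hat X y =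
     sqrt (scalar_prod (ls_resid X y) (ls_resid X y) / real (dim_row X - dim_col X))"

definition xi :: "real mat \<Rightarrow> nat \<Rightarrow> real" where
  "xi X i =
     sqrt (the (mat_inverse ((1 / real (dim_row X)) \<cdot>\<^sub>m (transpose_mat X * X))) $$ (i, i))"

definition hard_thr_est :: "real mat \<Rightarrow> real \<Rightarrow> nat \<Rightarrow> real Matrix.vec \<Rightarrow> real" where
  "hard_thr_est X eta i y =
     vec_index (ls_est X y) i *
     of_bool (\<bar>vec_index (ls_est X y) i\<bar> > sigma_hat X y * xi X i * eta)"


section \<open>The Gaussian linear model\<close>

text \<open>The law \<open>N(0, \<sigma>\<^sup>2 I\<^sub>n)\<close>, on the product space of functions on \<open>{..<n}\<close>.\<close>

definition iso_normal :: "nat \<Rightarrow> real \<Rightarrow> (nat \<Rightarrow> real) measure" where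
  "iso_normal n \<sigma> = PiM {..<n} (\<lambda>_. density lborel (\<lambda>x. ennreal (normal_density 0 \<sigma> x)))"

text \<open>
  \<open>Y = X \<theta> + u\<close> with \<open>u\<close> distributed as \<open>N(0, \<sigma>\<^sup>2 I\<^sub>n)\<close> under the probability measure \<open>M\<close>.
  The type \<open>real vec\<close> carries no \<open>\<sigma>\<close>-algebra here, so the random vector \<open>u = Y - X \<theta>\<close> enters
  through its coordinate function on \<open>{..<n}\<close>.
\<close>

definition err_coords ::
    "real mat \<Rightarrow> real Matrix.vec \<Rightarrow> ('a \<Rightarrow> real Matrix.vec) \<Rightarrow> 'a \<Rightarrow> nat \<Rightarrow> real" where
  "err_coords X \<theta> Y \<omega> = (\<lambda>j\<in>{..<dim_row X}. vec_index (Y \<omega> - X *\<^sub>v \<theta>) j)"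

definition gaussian_linear_model ::
    "'a measure \<Rightarrow> real mat \<Rightarrow> real Matrix.vec \<Rightarrow> real \<Rightarrow> ('a \<Rightarrow> real Matrix.vec) \<Rightarrow> bool" where
  "gaussian_linear_model M X \<theta> \<sigma> Y \<longleftrightarrow>
     prob_space M \<and>
     (\<forall>\<omega>\<in>space M. Y \<omega> \<in> carrier_vec (dim_row X)) \<and>
     err_coords X \<theta> Y \<in> M \<rightarrow>\<^sub>M PiM {..<dim_row X} (\<lambda>_. borel) \<and>
     distr M (PiM {..<dim_row X} (\<lambda>_. borel)) (err_coords X \<theta> Y) = iso_normal (dim_row X) \<sigma>"


section \<open>Limit distributions\<close>

definition Phi :: "ereal \<Rightarrow> real" where
  "Phi z = measure std_normal_distribution {x. ereal x \<le> z}"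

lemma Phi_ereal: "Phi (ereal x) = cdf std_normal_distribution x"
  by (simp add: Phi_def cdf_def atMost_def)

lemma Phi_infty: "Phi \<infinity> = 1" "Phi (-\<infinity>) = 0"
  using prob_space.prob_space[OF real_distribution.axioms(1)[OF real_dist_normal_dist]]
  by (simp_all add: Phi_def)

definition chi_square_distribution :: "nat \<Rightarrow> real measure" where
  "chi_square_distribution m =
     distr (PiM {..<m} (\<lambda>_. std_normal_distribution)) borel (\<lambda>z. \<Sum>j<m. (z j)\<^sup>2)"

text \<open>
  \<open>RN_deriv\<close> selects one version of the Lebesgue density; only integrals against \<open>rho m\<close> are used,
  and these do not depend on the version.
\<close>

definition rho :: "nat \<Rightarrow> real \<Rightarrow> real" where
  "rho m s =
     (if s < 0 then 0
      else enn2real (RN_deriv lborel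
             (distr (chi_square_distribution m) borel (\<lambda>x. sqrt x / sqrt (real m))) s))"

text \<open>
  The functions \<open>ht_cdf\<close> and \<open>ht_measure\<close> at \<open>c = e\<close> give the limit for \<open>n - k \<rightarrow> \<infinity>\<close>; for fixed
  \<open>n - k = m\<close> they are mixed over \<open>c = s * e\<close> with mixing density \<open>rho m\<close>. For infinite \<open>\<nu>\<close>, \<open>ereal\<close> arithmetic yields \<open>x + \<nu> = \<nu>\<close>.
\<close>

definition ht_cdf :: "ereal \<Rightarrow> real \<Rightarrow> real \<Rightarrow> real" where
  "ht_cdf \<nu> c x =
     Phi (ereal x) * of_bool (\<bar>ereal x + \<nu>\<bar> > ereal c)
     + Phi (- \<nu> + ereal c) * of_bool (0 \<le> ereal x + \<nu> \<and> ereal x + \<nu> \<le> ereal c)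
     + Phi (- \<nu> - ereal c) * of_bool (- ereal c \<le> ereal x + \<nu> \<and> ereal x + \<nu> < 0)"

text \<open>
  The measure \<open>w d\<delta>\<^sub>z(x) + g(x) dx\<close> on the Borel sets. For infinite \<open>z\<close> the indicator vanishes, so
  that the pointmass is absent. (If the set function were not a measure, \<open>measure_of\<close> would
  yield the zero measure, which is not a probability measure.)
\<close>

definition atom_plus_density :: "real \<Rightarrow> ereal \<Rightarrow> (real \<Rightarrow> real) \<Rightarrow> real measure" where
  "atom_plus_density w z g =
     measure_of UNIV (sets borel)
       (\<lambda>A. ennreal w * indicator (ereal ` A) z + (\<integral>\<^sup>+x\<in>A. ennreal (g x) \<partial>lborel))"

definition ht_measure :: "ereal \<Rightarrow> real \<Rightarrow> real measure" where
  "ht_measure \<nu> c =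
     atom_plus_density (Phi (- \<nu> + ereal c) - Phi (- \<nu> - ereal c)) (- \<nu>)
       (\<lambda>x. std_normal_density x * of_bool (\<bar>ereal x + \<nu>\<bar> > ereal c))"

definition ht_cdf_mix :: "nat \<Rightarrow> ereal \<Rightarrow> real \<Rightarrow> real \<Rightarrow> real" where
  "ht_cdf_mix m \<nu> e x = (LBINT s:{0..}. ht_cdf \<nu> (s * e) x * rho m s)"

definition ht_measure_mix :: "nat \<Rightarrow> ereal \<Rightarrow> real \<Rightarrow> real measure" where
  "ht_measure_mix m \<nu> e =
     atom_plus_density
       (LBINT s:{0..}. (Phi (- \<nu> + ereal (s * e)) - Phi (- \<nu> - ereal (s * e))) * rho m s)
       (- \<nu>)
       (\<lambda>x. std_normal_density x *
             (LBINT s:{0..}. of_bool (\<bar>ereal x + \<nu>\<bar> > ereal (s * e)) * rho m s))"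

end

theory Submission imports Defs begin

text \<open>
  Write \<open>m = n - k\<close>. Least squares splits the Gaussian error orthogonally: the component of the
  error along one unit vector of the column space of \<open>X\<close> determines the \<open>i\<close>-th estimation error, and
  its components along an orthonormal basis of the orthogonal complement of the column space
  determine the residual. An orthonormal system applied to \<open>N(0, \<sigma>\<^sup>2 I)\<close> gives independent
  normal variables, so the \<open>i\<close>-th component of the least-squares estimator is
  \<open>\<theta>\<^sub>i + \<sigma> \<xi> w / sqrt n\<close> and the estimate of \<open>\<sigma>\<close> is \<open>\<sigma> S\<close>, where \<open>w\<close> is standard normal and
  independent of \<open>S\<close>, the square root of a chi-square variable over its number \<open>m\<close> of degrees of
  freedom (\<open>least_squares_orthonormal\<close>, \<open>distr_iso_normal_orthonormal\<close>, \<open>scaled_chi_pair\<close>).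

  Put \<open>\<nu>\<^sub>n = sqrt n \<theta>\<^sub>i / (\<sigma> \<xi>)\<close> and \<open>e\<^sub>n = sqrt n \<eta>\<close>. After division by \<open>\<sigma> \<xi> / sqrt n\<close> the
  thresholding condition becomes \<open>\<bar>w + \<nu>\<^sub>n\<bar> > S e\<^sub>n\<close>, so that the scaled estimation error is exactly
  \<open>w\<close> if this holds and \<open>-\<nu>\<^sub>n\<close> otherwise (\<open>distr_hard_thr_est\<close>). Its law, called \<open>ht_law\<close> below,
  depends on the sample size only through \<open>\<nu>\<^sub>n\<close>, \<open>e\<^sub>n\<close> and the law of \<open>S\<close>.

  Each of the three converges. For constant \<open>m\<close> the law of \<open>S\<close> does not change; for \<open>m \<rightarrow> \<infinity>\<close> it
  tends to the pointmass at 1 because \<open>S\<^sup>2\<close> has mean 1 and variance \<open>2 / m\<close>. The map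
  \<open>(\<nu>, c, w) \<mapsto> (if \<bar>w + \<nu>\<bar> > c then w else -\<nu>)\<close> is continuous where \<open>\<bar>w + \<nu>\<bar> \<noteq> c\<close>, and for a normal
  \<open>w\<close> independent of \<open>c\<close> equality has probability 0. For infinite \<open>\<nu>\<close> the threshold is eventually
  exceeded, which leaves \<open>w\<close>. Hence the law with \<open>\<nu>\<close>, \<open>e\<close> and the limit law of \<open>S\<close> is the limit in
  both cases (\<open>weak_conv_ht_law\<close>), and Fubini's theorem turns it into the stated cdf and the stated
  pointmass plus density (\<open>cdf_ht_law\<close>, \<open>atom_plus_density_ht_law\<close>): part (a) mixes over the
  scaled chi distribution, part (b) over the pointmass at 1.
\<close>

section \<open>Independence from characteristic functions\<close>

text \<open>
  If \<open>R\<close> has the same expectation against every \<open>exp (i t Z)\<close> as a constant \<open>r\<close> has, the same holds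
  for every indicator of an event in \<open>Z\<close>. Adding a constant makes \<open>R\<close> a positive weight; under the
  reweighted probability measure \<open>Z\<close> keeps its characteristic function, hence, by Levy's uniqueness
  theorem on the line, its distribution.
\<close>

lemma (in prob_space) expectation_indicator_of_char_real:
  fixes R Z :: "'a \<Rightarrow> real"
  assumes [measurable]: "R \<in> borel_measurable M" "Z \<in> borel_measurable M"
    and bd: "\<And>\<omega>. \<bar>R \<omega>\<bar> \<le> B"
    and N: "distr M borel Z = N"
    and eq: "\<And>t. (CLINT \<omega>|M. R \<omega> * iexp (t * Z \<omega>)) = r * char N t"
    and A [measurable]: "A \<in> sets borel"
  shows "(LINT \<omega>|M. R \<omega> * indicator A (Z \<omega>)) = r * measure N A"
proof -
  have N': "real_distribution N"
    unfolding N[symmetric] by (rule real_distribution_distr) simp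
  interpret N: real_distribution N by fact
  have intR: "integrable M R"
    by (rule integrable_const_bound[of _ B]) (auto simp: bd)
  have "complex_of_real (expectation R) = complex_of_real r"
    using eq[of 0] by (simp add: N.char_zero del: of_real_eq_iff)
  then have r: "expectation R = r" by (simp only: of_real_eq_iff)
  have "\<bar>r\<bar> \<le> B"
    using integral_abs_bound[of M R] integral_mono[of M "\<lambda>\<omega>. \<bar>R \<omega>\<bar>" "\<lambda>_. B"] intR bd
    by (simp add: r prob_space)
  \<comment> \<open>Since \<open>\<bar>r\<bar> \<le> B\<close>, this choice makes \<open>b + R\<close> nonnegative and its mean \<open>b + r\<close> at least 1.\<close>
  define b where "b = B + 1"
  define f where "f \<omega> = (b + R \<omega>) / (b + r)" for \<omega>
  have br: "b + r > 0" using \<open>\<bar>r\<bar> \<le> B\<close> by (simp add: b_def)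
  have f0: "0 \<le> f \<omega>" for \<omega>
    using bd[of \<omega>] br by (simp add: f_def b_def)
  have fm [measurable]: "f \<in> borel_measurable M" unfolding f_def[abs_def] by measurable
  have intf: "integrable M f"
    unfolding f_def[abs_def] using intR by auto
  have "expectation f = 1"
    unfolding f_def[abs_def] using intR br by (simp add: r prob_space)
  define D where "D = density M (\<lambda>\<omega>. ennreal (f \<omega>))"
  have D: "prob_space D"
  proof
    show "emeasure D (space D) = 1"
      unfolding D_def using \<open>expectation f = 1\<close> intf f0
      by (subst emeasure_density) (auto simp: nn_integral_eq_integral cong: nn_integral_cong_simp)
  qed
  have [measurable]: "Z \<in> borel_measurable D" by (simp add: D_def)
  have "real_distribution (distr D borel Z)"
    by (intro prob_space.real_distribution_distr D) simp
  moreover have "char (distr D borel Z) = char N"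
  proof
    fix t
    have i1: "integrable M (\<lambda>\<omega>. iexp (t * Z \<omega>))"
      by (rule integrable_const_bound[of _ 1]) auto
    have i2: "integrable M (\<lambda>\<omega>. R \<omega> * iexp (t * Z \<omega>))"
      by (rule integrable_const_bound[of _ B]) (auto simp: norm_mult bd)
    have "char (distr D borel Z) t = (CLINT \<omega>|D. iexp (t * Z \<omega>))"
      unfolding char_def by (subst integral_distr) auto
    also have "\<dots> = (CLINT \<omega>|M. f \<omega> *\<^sub>R iexp (t * Z \<omega>))"
      unfolding D_def by (subst integral_density) (auto simp: f0)
    also have "\<dots> = (CLINT \<omega>|M. (b * iexp (t * Z \<omega>) + R \<omega> * iexp (t * Z \<omega>)) / (b + r))"
      by (rule Bochner_Integration.integral_cong)
         (auto simp: f_def scaleR_conv_of_real algebra_simps add_divide_distrib)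
    also have "\<dots> = (b * (CLINT \<omega>|M. iexp (t * Z \<omega>)) + r * char N t) / (b + r)"
      using i1 i2 eq[of t] by simp
    also have "(CLINT \<omega>|M. iexp (t * Z \<omega>)) = char N t"
      unfolding char_def N[symmetric] by (subst integral_distr) auto
    also have "(b * char N t + r * char N t) / (b + r) = char N t"
    proof -
      have "complex_of_real (b + r) \<noteq> 0" using br by (metis of_real_eq_0_iff less_irrefl)
      then show ?thesis by (simp add: field_simps)
    qed
    finally show "char (distr D borel Z) t = char N t" .
  qed
  ultimately have DN: "distr D borel Z = N"
    using N' by (intro Levy_uniqueness)
  have i3: "integrable M (\<lambda>\<omega>. R \<omega> * indicator A (Z \<omega>))"
    by (rule integrable_const_bound[of _ "\<bar>B\<bar>"])
       (auto simp: indicator_def intro: order_trans[OF bd abs_ge_self])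
  have i4: "integrable M (\<lambda>\<omega>. indicator A (Z \<omega>) :: real)"
    by (rule integrable_const_bound[of _ 1]) (auto simp: indicator_def)
  have "measure N A = (LINT z|N. indicator A z)" by simp
  also have "\<dots> = (LINT \<omega>|D. indicator A (Z \<omega>))"
    unfolding DN[symmetric] by (subst integral_distr) auto
  also have "\<dots> = (LINT \<omega>|M. f \<omega> *\<^sub>R indicator A (Z \<omega>))"
    unfolding D_def by (subst integral_density) (auto simp: f0)
  also have "\<dots> = (LINT \<omega>|M. (b * indicator A (Z \<omega>) + R \<omega> * indicator A (Z \<omega>)) / (b + r))"
    by (rule Bochner_Integration.integral_cong) (auto simp: f_def algebra_simps add_divide_distrib)
  also have "\<dots> = (b * (LINT \<omega>|M. indicator A (Z \<omega>)) + (LINT \<omega>|M. R \<omega> * indicator A (Z \<omega>))) / (b + r)"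
    using i3 i4 by simp
  also have "(LINT \<omega>|M. indicator A (Z \<omega>)) = (LINT z|N. indicator A z :: real)"
    unfolding N[symmetric] by (subst integral_distr) auto
  finally show ?thesis using br by (simp add: field_simps)
qed

text \<open>
  The complex version lets \<open>W\<close> contain exponentials of further variables. Applied to one variable
  after another, it derives joint independence from a factorising joint characteristic function
  with the uniqueness theorem for distributions on the line alone.
\<close>

lemma (in prob_space) expectation_indicator_of_char:
  fixes W :: "'a \<Rightarrow> complex" and Z :: "'a \<Rightarrow> real"
  assumes [measurable]: "W \<in> borel_measurable M" "Z \<in> borel_measurable M"
    and bd: "\<And>\<omega>. norm (W \<omega>) \<le> B"
    and N: "distr M borel Z = N"
    and eq: "\<And>t. (CLINT \<omega>|M. W \<omega> * iexp (t * Z \<omega>)) = c * char N t"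
    and A [measurable]: "A \<in> sets borel"
  shows "(CLINT \<omega>|M. W \<omega> * indicator A (Z \<omega>)) = c * measure N A"
proof -
  have [measurable]: "(\<lambda>\<omega>. cnj (W \<omega>)) \<in> borel_measurable M"
    by (rule measurable_compose[OF assms(1) borel_measurable_continuous_onI]) (intro continuous_intros)
  have i: "integrable M (\<lambda>\<omega>. W \<omega> * iexp (t * Z \<omega>))"
     "integrable M (\<lambda>\<omega>. cnj (W \<omega>) * iexp (t * Z \<omega>))" for t
    by (rule integrable_const_bound[of _ B]; auto simp: norm_mult bd)+
  \<comment> \<open>Conjugation turns \<open>t\<close> into \<open>-t\<close>, so the hypothesis passes to the conjugate of \<open>W\<close> and hence to
    its real and imaginary parts.\<close>
  have cnj_eq: "(CLINT \<omega>|M. cnj (W \<omega>) * iexp (t * Z \<omega>)) = cnj c * char N t" for t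
  proof -
    have "(CLINT \<omega>|M. cnj (W \<omega>) * iexp (t * Z \<omega>)) = (CLINT \<omega>|M. cnj (W \<omega> * iexp (- t * Z \<omega>)))"
      by (rule Bochner_Integration.integral_cong) (auto simp: exp_cnj)
    also have "\<dots> = cnj (c * char N (- t))" by (simp only: Bochner_Integration.integral_cnj eq)
    also have "cnj (char N (- t)) = char N t"
      unfolding char_def Bochner_Integration.integral_cnj[symmetric] by (simp add: exp_cnj)
    then have "cnj (c * char N (- t)) = cnj c * char N t" by simp
    finally show ?thesis .
  qed
  have Re: "(LINT \<omega>|M. Re (W \<omega>) * indicator A (Z \<omega>)) = Re c * measure N A"
  proof (rule expectation_indicator_of_char_real[where B = B])
    fix t
    have "(CLINT \<omega>|M. Re (W \<omega>) * iexp (t * Z \<omega>))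
        = (CLINT \<omega>|M. (W \<omega> * iexp (t * Z \<omega>) + cnj (W \<omega>) * iexp (t * Z \<omega>)) / 2)"
      by (rule Bochner_Integration.integral_cong)
         (auto simp: complex_add_cnj simp flip: distrib_right)
    also have "\<dots> = (c + cnj c) * char N t / 2"
      using i[of t] eq[of t] cnj_eq[of t] by (simp add: distrib_right)
    finally show "(CLINT \<omega>|M. Re (W \<omega>) * iexp (t * Z \<omega>)) = Re c * char N t"
      by (simp add: complex_add_cnj)
  qed (use N bd abs_Re_le_cmod order_trans in \<open>auto, blast\<close>)
  have ii: "\<i> * (a * (\<i> * b)) = - (a * b)" for a b :: complex
    by (metis complex_i_mult_minus mult.left_commute)
  have Im: "(LINT \<omega>|M. Im (W \<omega>) * indicator A (Z \<omega>)) = Im c * measure N A"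
  proof (rule expectation_indicator_of_char_real[where B = B])
    fix t
    have "(CLINT \<omega>|M. Im (W \<omega>) * iexp (t * Z \<omega>))
        = (CLINT \<omega>|M. (W \<omega> * iexp (t * Z \<omega>) - cnj (W \<omega>) * iexp (t * Z \<omega>)) / (2 * \<i>))"
      by (rule Bochner_Integration.integral_cong)
         (auto simp: complex_diff_cnj field_simps ii simp flip: left_diff_distrib)
    also have "\<dots> = (c - cnj c) * char N t / (2 * \<i>)"
      using i[of t] eq[of t] cnj_eq[of t] by (simp add: left_diff_distrib)
    finally show "(CLINT \<omega>|M. Im (W \<omega>) * iexp (t * Z \<omega>)) = Im c * char N t"
      by (simp add: complex_diff_cnj ii)
  qed (use N bd abs_Im_le_cmod order_trans in \<open>auto, blast\<close>)
  have j: "integrable M (\<lambda>\<omega>. W \<omega> * indicator A (Z \<omega>))"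
    by (rule integrable_const_bound[of _ "\<bar>B\<bar>"])
       (auto simp: indicator_def intro: order_trans[OF bd abs_ge_self])
  show ?thesis
  proof (rule complex_eqI)
    have *: "Re (W \<omega> * indicator A (Z \<omega>)) = Re (W \<omega>) * indicator A (Z \<omega>)"
      "Im (W \<omega> * indicator A (Z \<omega>)) = Im (W \<omega>) * indicator A (Z \<omega>)" for \<omega>
      by (auto simp: indicator_def)
    show "Re (CLINT \<omega>|M. W \<omega> * indicator A (Z \<omega>)) = Re (c * measure N A)"
      using integral_Re[OF j, symmetric] Re by (simp only: *) simp
    show "Im (CLINT \<omega>|M. W \<omega> * indicator A (Z \<omega>)) = Im (c * measure N A)"
      using integral_Im[OF j, symmetric] Im by (simp only: *) simp
  qed
qed

section \<open>Orthonormal images of the isotropic normal law\<close>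

lemma distr_std_normal_scale:
  assumes "0 < \<sigma>"
  shows "distr std_normal_distribution borel (\<lambda>x. \<sigma> * x)
       = density lborel (\<lambda>x. ennreal (normal_density 0 \<sigma> x))"
proof -
  interpret prob_space std_normal_distribution
    by (rule prob_space_normal_density) simp
  have "distributed std_normal_distribution lborel (\<lambda>x. x) std_normal_density"
    by (simp add: distributed_def distr_id2 cong: distr_cong)
  from normal_density_affine[OF this, of \<sigma> 0] assms
  show ?thesis
    by (simp add: distributed_def normal_density_def cong: distr_cong)
qed

lemma char_normal:
  assumes "0 < \<sigma>"
  shows "char (density lborel (\<lambda>x. ennreal (normal_density 0 \<sigma> x))) t = exp (- (\<sigma> * t)\<^sup>2 / 2)"
proof -
  have "char (density lborel (\<lambda>x. ennreal (normal_density 0 \<sigma> x))) t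
      = char std_normal_distribution (t * \<sigma>)"
    unfolding distr_std_normal_scale[OF assms, symmetric] char_def
    by (subst integral_distr) (auto simp: mult.assoc)
  then show ?thesis
    by (simp add: char_std_normal_distribution mult.commute)
qed

lemma sum_orthonormal_square:
  fixes q :: "nat \<Rightarrow> nat \<Rightarrow> real"
  assumes q: "\<And>j j'. j < p \<Longrightarrow> j' < p \<Longrightarrow> (\<Sum>l<n. q j l * q j' l) = of_bool (j = j')"
  shows "(\<Sum>l<n. (\<Sum>j<p. t j * q j l)\<^sup>2) = (\<Sum>j<p. (t j)\<^sup>2)"
proof -
  have "(\<Sum>l<n. (\<Sum>j<p. t j * q j l)\<^sup>2)
      = (\<Sum>l<n. \<Sum>j<p. \<Sum>j'<p. t j * t j' * (q j l * q j' l))"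
    by (simp add: power2_eq_square sum_product ac_simps)
  also have "\<dots> = (\<Sum>j<p. \<Sum>j'<p. t j * t j' * (\<Sum>l<n. q j l * q j' l))"
    by (subst sum.swap, rule sum.cong[OF refl], subst sum.swap) (simp add: sum_distrib_left)
  also have "\<dots> = (\<Sum>j<p. \<Sum>j'<p. if j = j' then t j * t j' else 0)"
    by (intro sum.cong refl) (auto simp: q)
  also have "\<dots> = (\<Sum>j<p. (t j)\<^sup>2)"
    by (simp add: power2_eq_square)
  finally show ?thesis .
qed

lemma char_iso_normal_orthonormal:
  fixes q :: "nat \<Rightarrow> nat \<Rightarrow> real"
  assumes q: "\<And>j j'. j < p \<Longrightarrow> j' < p \<Longrightarrow> (\<Sum>l<n. q j l * q j' l) = of_bool (j = j')"
    and \<sigma>: "0 < \<sigma>"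
  shows "(CLINT u|iso_normal n \<sigma>. iexp (\<Sum>j<p. t j * ((\<Sum>l<n. q j l * u l) / \<sigma>)))
       = (\<Prod>j<p. char std_normal_distribution (t j))"
proof -
  let ?D = "\<lambda>_::nat. density lborel (\<lambda>x. ennreal (normal_density 0 \<sigma> x))"
  interpret D: prob_space "?D l" for l by (rule prob_space_normal_density[OF \<sigma>])
  interpret P: product_prob_space ?D by unfold_locales
  define b where "b l = (\<Sum>j<p. t j * q j l) / \<sigma>" for l
  have lin: "(\<Sum>j<p. t j * ((\<Sum>l<n. q j l * u l) / \<sigma>)) = (\<Sum>l<n. b l * u l)" for u
    unfolding b_def by (simp add: sum_distrib_left sum_distrib_right sum_divide_distrib ac_simps, subst sum.swap) simp
  have "(CLINT u|iso_normal n \<sigma>. iexp (\<Sum>j<p. t j * ((\<Sum>l<n. q j l * u l) / \<sigma>)))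
      = (CLINT u|PiM {..<n} ?D. (\<Prod>l<n. iexp (b l * u l)))"
    unfolding lin iso_normal_def by (simp add: exp_sum sum_distrib_left)
  also have "\<dots> = (\<Prod>l<n. CLINT x|?D l. iexp (b l * x))"
  proof (rule P.product_integral_prod)
    show "integrable (?D l) (\<lambda>x. iexp (b l * x))" for l
      by (rule D.integrable_const_bound[of _ 1]) auto
  qed simp
  also have "\<dots> = (\<Prod>l<n. exp (- (\<sigma> * b l)\<^sup>2 / 2))"
    using char_normal[OF \<sigma>] unfolding char_def by simp
  also have "\<dots> = exp (- (\<Sum>l<n. (\<sigma> * b l)\<^sup>2) / 2)"
    by (simp add: exp_sum[symmetric] sum_negf sum_divide_distrib del: of_real_exp flip: of_real_prod)
  also have "(\<Sum>l<n. (\<sigma> * b l)\<^sup>2) = (\<Sum>j<p. (t j)\<^sup>2)"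
    using sum_orthonormal_square[where t = t, OF q, of p] \<sigma> by (simp add: b_def)
  also have "exp (- (\<Sum>j<p. (t j)\<^sup>2) / 2) = (\<Prod>j<p. char std_normal_distribution (t j))"
    by (simp add: char_std_normal_distribution exp_sum[symmetric] sum_negf sum_divide_distrib
         del: of_real_exp flip: of_real_prod)
  finally show ?thesis .
qed

text \<open>
  The joint characteristic function of the coordinates along an orthonormal system factorises. The
  indicators of a box replace the exponentials one coordinate at a time.
\<close>

lemma distr_iso_normal_orthonormal:
  fixes q :: "nat \<Rightarrow> nat \<Rightarrow> real"
  assumes q: "\<And>j j'. j < p \<Longrightarrow> j' < p \<Longrightarrow> (\<Sum>l<n. q j l * q j' l) = of_bool (j = j')"
    and \<sigma>: "0 < \<sigma>"
  shows "distr (iso_normal n \<sigma>) (PiM {..<p} (\<lambda>_. borel)) (\<lambda>u. \<lambda>j\<in>{..<p}. (\<Sum>l<n. q j l * u l) / \<sigma>)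
       = PiM {..<p} (\<lambda>_. std_normal_distribution)"
proof -
  let ?M = "iso_normal n \<sigma>" and ?N = "std_normal_distribution"
  let ?Z = "\<lambda>j u. (\<Sum>l<n. q j l * u l) / \<sigma>"
  interpret M: prob_space ?M
    unfolding iso_normal_def by (intro prob_space_PiM prob_space_normal_density \<sigma>)
  interpret N: real_distribution ?N by (rule real_dist_normal_dist)
  interpret P: product_prob_space "\<lambda>_::nat. ?N" by unfold_locales
  have [measurable]: "(\<lambda>u. u l) \<in> borel_measurable ?M" if "l \<in> {..<n}" for l
    unfolding iso_normal_def using measurable_component_singleton[OF that, of "\<lambda>_. density lborel (\<lambda>x. ennreal (normal_density 0 \<sigma> x))"]
    by simp
  have Zm [measurable]: "?Z j \<in> borel_measurable ?M" for j
    by (intro borel_measurable_divide borel_measurable_sum borel_measurable_times) auto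
  have char_Z: "(CLINT u|?M. iexp (\<Sum>j<p. t j * ?Z j u)) = (\<Prod>j<p. char ?N (t j))" for t
    by (rule char_iso_normal_orthonormal[OF _ \<sigma>]) (rule q)
  have law: "distr ?M borel (?Z j) = ?N" if "j < p" for j
  proof (rule Levy_uniqueness)
    show "char (distr ?M borel (?Z j)) = char ?N"
    proof
      fix t
      have *: "(\<Sum>j'<p. (if j' = j then t else 0) * ?Z j' u) = t * ?Z j u" for u
      proof -
        have "(\<Sum>j'<p. (if j' = j then t else 0) * ?Z j' u) = (\<Sum>j'<p. if j' = j then t * ?Z j u else 0)"
          by (intro sum.cong refl) auto
        then show ?thesis using that by simp
      qed
      have "char (distr ?M borel (?Z j)) t = (CLINT u|?M. iexp (t * ?Z j u))"
        unfolding char_def by (subst integral_distr) auto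
      also have "\<dots> = (\<Prod>j'<p. char ?N (if j' = j then t else 0))"
        using char_Z[of "\<lambda>j'. if j' = j then t else 0"]
        unfolding * by simp
      also have "\<dots> = (\<Prod>j'<p. if j' = j then char ?N t else 1)"
        by (intro prod.cong refl) (auto simp: N.char_zero)
      also have "\<dots> = char ?N t" using that by (simp add: prod.delta)
      finally show "char (distr ?M borel (?Z j)) t = char ?N t" .
    qed
  qed (auto intro: M.real_distribution_distr real_dist_normal_dist)
  show ?thesis
  proof (rule P.PiM_eqI)
    fix A :: "nat \<Rightarrow> real set" assume "\<And>j. j \<in> {..<p} \<Longrightarrow> A j \<in> sets ?N"
    then have A [measurable]: "A j \<in> sets borel" if "j < p" for j using that by simp
    \<comment> \<open>Indicators below \<open>l\<close>, exponentials from \<open>l\<close> on: \<open>l = 0\<close> is the joint characteristic function,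
      \<open>l = p\<close> the probability of the box.\<close>
    have main: "l \<le> p \<Longrightarrow> (CLINT u|?M. (\<Prod>j<l. indicator (A j) (?Z j u)) * iexp (\<Sum>j\<in>{l..<p}. t j * ?Z j u))
        = (\<Prod>j<l. of_real (measure ?N (A j))) * (\<Prod>j\<in>{l..<p}. char ?N (t j))" for l t
    proof (induction l arbitrary: t)
      case 0
      then show ?case
        using char_Z[of t] by (simp add: atLeast0LessThan)
    next
      case (Suc l)
      then have l: "l < p" by simp
      define W where "W u = (\<Prod>j<l. indicator (A j) (?Z j u)) * iexp (\<Sum>j\<in>{Suc l..<p}. t j * ?Z j u)" for u
      define c where "c = (\<Prod>j<l. complex_of_real (measure ?N (A j))) * (\<Prod>j\<in>{Suc l..<p}. char ?N (t j))"
      have "(CLINT u|?M. W u * indicator (A l) (?Z l u)) = c * measure ?N (A l)"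
      proof (rule M.expectation_indicator_of_char[where B = 1])
        show "W \<in> borel_measurable ?M"
          unfolding W_def[abs_def]
          by (intro borel_measurable_times borel_measurable_prod borel_measurable_exp
              borel_measurable_of_real borel_measurable_sum borel_measurable_indicator'
              borel_measurable_const Zm) (use l Zm in \<open>auto intro: measurable_sets\<close>)
        show "norm (W u) \<le> 1" for u
          unfolding W_def norm_mult norm_exp_i_times prod_norm[symmetric]
          by (auto intro!: prod_le_1 simp: indicator_def)
        show "distr ?M borel (?Z l) = ?N" by (rule law[OF l])
        show "(CLINT u|?M. W u * iexp (s * ?Z l u)) = c * char ?N s" for s
        proof -
          have "(\<Sum>j\<in>{Suc l..<p}. (t(l := s)) j * ?Z j u) = (\<Sum>j\<in>{Suc l..<p}. t j * ?Z j u)" for u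
            by (intro sum.cong refl) auto
          then have S: "(\<Sum>j\<in>{l..<p}. (t(l := s)) j * ?Z j u) = (\<Sum>j\<in>{Suc l..<p}. t j * ?Z j u) + s * ?Z l u" for u
            by (simp add: sum.atLeast_Suc_lessThan[OF l])
          have "(\<Prod>j\<in>{Suc l..<p}. char ?N ((t(l := s)) j)) = (\<Prod>j\<in>{Suc l..<p}. char ?N (t j))"
            by (intro prod.cong refl) auto
          then have P: "(\<Prod>j\<in>{l..<p}. char ?N ((t(l := s)) j)) = char ?N s * (\<Prod>j\<in>{Suc l..<p}. char ?N (t j))"
            by (simp add: prod.atLeast_Suc_lessThan[OF l])
          have "(CLINT u|?M. W u * iexp (s * ?Z l u)) =
            (CLINT u|?M. (\<Prod>j<l. indicator (A j) (?Z j u)) * iexp (\<Sum>j\<in>{l..<p}. (t(l := s)) j * ?Z j u))"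
            unfolding S W_def by (simp only: of_real_add distrib_left exp_add mult.assoc)
          also have "\<dots> = c * char ?N s"
            unfolding Suc.IH[OF less_imp_le[OF l]] P c_def by (simp only: ac_simps)
          finally show ?thesis .
        qed
      qed (use l in auto)
      then show ?case
        by (simp add: W_def c_def ac_simps)
    qed
    let ?f = "\<lambda>u. \<lambda>j\<in>{..<p}. ?Z j u"
    have fm: "?f \<in> ?M \<rightarrow>\<^sub>M PiM {..<p} (\<lambda>_. borel)" by measurable
    have PE: "Pi\<^sub>E {..<p} A \<in> sets (PiM {..<p} (\<lambda>_. borel))"
      by (intro sets_PiM_I_finite) auto
    define S where "S = ?f -` Pi\<^sub>E {..<p} A \<inter> space ?M"
    have ind: "complex_of_real (indicator S u) = (\<Prod>j<p. indicator (A j) (?Z j u))" if u: "u \<in> space ?M" for u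
    proof (cases "\<forall>j<p. ?Z j u \<in> A j")
      case True
      then have "u \<in> S" using u by (simp add: S_def)
      with True show ?thesis by simp
    next
      case False
      then obtain j where j: "j < p" "?Z j u \<notin> A j" by auto
      then have "u \<notin> S" by (auto simp: S_def PiE_iff)
      moreover have "(\<Prod>j<p. indicator (A j) (?Z j u)) = (0 :: complex)"
        using j by (intro prod_zero bexI[of _ j]) auto
      ultimately show ?thesis by simp
    qed
    have "complex_of_real (measure ?M S) = (CLINT u|?M. complex_of_real (indicator S u))"
      using measurable_sets[OF fm PE] by (simp add: S_def)
    also have "\<dots> = (CLINT u|?M. (\<Prod>j<p. indicator (A j) (?Z j u)))"
      by (rule Bochner_Integration.integral_cong[OF refl ind])
    also have "\<dots> = complex_of_real (\<Prod>j<p. measure ?N (A j))"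
      using main[of p "\<lambda>_. 0"] by simp
    finally have "measure ?M S = (\<Prod>j<p. measure ?N (A j))"
      by (simp only: of_real_eq_iff)
    then show "emeasure (distr ?M (PiM {..<p} (\<lambda>_. borel)) ?f) (Pi\<^sub>E {..<p} A) = (\<Prod>j\<in>{..<p}. emeasure ?N (A j))"
      by (simp add: emeasure_distr[OF fm PE] S_def M.emeasure_eq_measure N.emeasure_eq_measure prod_ennreal)
  qed (auto intro!: sets_PiM_cong)
qed

section \<open>Least squares in orthonormal coordinates\<close>

text \<open>
  A symmetric idempotent matrix projects orthogonally onto a space whose dimension is its trace. A
  nonzero column, normalised, lies in that space; subtracting the projection onto it leaves a
  symmetric idempotent matrix with trace one less.
\<close>

lemma symmetric_idempotent_orthonormal:
  fixes M :: "nat \<Rightarrow> nat \<Rightarrow> real"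
  assumes "\<And>a b. a < n \<Longrightarrow> b < n \<Longrightarrow> M a b = M b a"
    and "\<And>a b. a < n \<Longrightarrow> b < n \<Longrightarrow> (\<Sum>l<n. M a l * M l b) = M a b"
    and "(\<Sum>l<n. M l l) = real r"
  shows "\<exists>q. (\<forall>j<r. \<forall>j'<r. (\<Sum>l<n. q j l * q j' l) = of_bool (j = j')) \<and>
             (\<forall>a<n. \<forall>b<n. M a b = (\<Sum>j<r. q j a * q j b))"
  using assms
proof (induction r arbitrary: M)
  case (0 M)
  have sq: "(\<Sum>l<n. (M a l)\<^sup>2) = M a a" if "a < n" for a
  proof -
    have "(M a l)\<^sup>2 = M a l * M l a" if "l < n" for l
      using 0(1)[OF \<open>a < n\<close> that] by (simp add: power2_eq_square)
    then show ?thesis using 0(2)[OF that that] by simp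
  qed
  have "(\<Sum>a<n. \<Sum>l<n. (M a l)\<^sup>2) = 0"
    using 0(3) by (simp add: sq)
  then have "M a b = 0" if "a < n" "b < n" for a b
    using that by (auto simp: sum_nonneg_eq_0_iff sum_nonneg)
  then show ?case by simp
next
  case (Suc r M)
  have sq: "(\<Sum>l<n. (M a l)\<^sup>2) = M a a" if "a < n" for a
  proof -
    have "(M a l)\<^sup>2 = M a l * M l a" if "l < n" for l
      using Suc.prems(1)[OF \<open>a < n\<close> that] by (simp add: power2_eq_square)
    then show ?thesis using Suc.prems(2)[OF that that] by simp
  qed
  have "\<exists>a<n. M a a \<noteq> 0"
  proof (rule ccontr)
    assume "\<not> (\<exists>a<n. M a a \<noteq> 0)"
    then have "(\<Sum>l<n. M l l) = 0" by simp
    with Suc.prems(3) show False by simp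
  qed
  then obtain a where a: "a < n" "M a a \<noteq> 0" by auto
  have "M a a \<ge> 0" unfolding sq[OF a(1), symmetric] by (simp add: sum_nonneg)
  with a have pos: "M a a > 0" by simp
  define v where "v b = M b a / sqrt (M a a)" for b
  have vv: "v b * v c = M b a * M c a / M a a" for b c
    using pos by (simp add: v_def)
  have v1: "(\<Sum>l<n. v l * v l) = 1"
  proof -
    have "(M a l)\<^sup>2 = M l a * M l a" if "l < n" for l
      using Suc.prems(1)[OF a(1) that] by (simp add: power2_eq_square)
    then show ?thesis
      using sq[OF a(1)] pos by (simp add: vv flip: sum_divide_distrib)
  qed
  have Mv: "(\<Sum>l<n. M b l * v l) = v b" if "b < n" for b
    using Suc.prems(2)[OF that a(1)] by (simp add: v_def flip: sum_divide_distrib)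
  define M' where "M' b c = M b c - v b * v c" for b c
  have "\<exists>q. (\<forall>j<r. \<forall>j'<r. (\<Sum>l<n. q j l * q j' l) = of_bool (j = j')) \<and>
             (\<forall>a<n. \<forall>b<n. M' a b = (\<Sum>j<r. q j a * q j b))"
  proof (rule Suc.IH)
    show "M' b c = M' c b" if "b < n" "c < n" for b c
      using Suc.prems(1)[OF that] by (simp add: M'_def mult.commute)
    show "(\<Sum>l<n. M' b l * M' l c) = M' b c" if bc: "b < n" "c < n" for b c
    proof -
      have "(\<Sum>l<n. M' b l * M' l c) = (\<Sum>l<n. M b l * M l c) - (\<Sum>l<n. M b l * v l) * v c
           - v b * (\<Sum>l<n. M l c * v l) + v b * (\<Sum>l<n. v l * v l) * v c"
        by (simp add: M'_def algebra_simps sum_distrib_left sum_distrib_right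
            flip: sum_subtractf sum.distrib)
      also have "(\<Sum>l<n. M l c * v l) = v c"
        unfolding Mv[OF bc(2), symmetric] by (intro sum.cong refl) (simp add: Suc.prems(1)[OF _ bc(2)])
      finally show ?thesis using bc by (simp add: Suc.prems(2) Mv v1 M'_def)
    qed
    show "(\<Sum>l<n. M' l l) = real r"
      using Suc.prems(3) v1 by (simp add: M'_def sum_subtractf)
  qed
  then obtain q where
    q1: "\<And>j j'. j < r \<Longrightarrow> j' < r \<Longrightarrow> (\<Sum>l<n. q j l * q j' l) = of_bool (j = j')" and
    q2: "\<And>a b. a < n \<Longrightarrow> b < n \<Longrightarrow> M' a b = (\<Sum>j<r. q j a * q j b)" by blast
  \<comment> \<open>The sum of squares is the quadratic form of \<open>M'\<close> at \<open>v\<close>, and \<open>M'\<close> annihilates \<open>v\<close>.\<close>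
  have "(\<Sum>j<r. (\<Sum>l<n. q j l * v l)\<^sup>2) = (\<Sum>j<r. \<Sum>b<n. \<Sum>c<n. q j b * v b * (q j c * v c))"
    by (simp add: power2_eq_square sum_product)
  also have "\<dots> = (\<Sum>b<n. \<Sum>c<n. \<Sum>j<r. q j b * v b * (q j c * v c))"
    by (subst sum.swap, rule sum.cong[OF refl], rule sum.swap)
  also have "\<dots> = (\<Sum>b<n. \<Sum>c<n. v b * v c * M' b c)"
    by (intro sum.cong refl) (simp add: q2 sum_distrib_left ac_simps)
  also have "\<dots> = (\<Sum>b<n. v b * ((\<Sum>c<n. M b c * v c) - v b * (\<Sum>c<n. v c * v c)))"
    by (simp add: M'_def algebra_simps sum_distrib_left flip: sum_subtractf)
  also have "\<dots> = 0" by (rule sum.neutral) (simp add: Mv v1)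
  finally have orth: "(\<Sum>l<n. q j l * v l) = 0" if "j < r" for j
    using that by (simp add: sum_nonneg_eq_0_iff)
  have orth': "(\<Sum>l<n. v l * q j l) = 0" if "j < r" for j
    using orth[OF that] by (simp add: mult.commute)
  show ?case
  proof (intro exI[of _ "q(r := v)"] conjI allI impI)
    fix j j' assume "j < Suc r" "j' < Suc r"
    then show "(\<Sum>l<n. (q(r := v)) j l * (q(r := v)) j' l) = of_bool (j = j')"
      by (auto simp: less_Suc_eq q1 orth orth' v1)
  next
    fix b c assume bc: "b < n" "c < n"
    have "M b c = M' b c + v b * v c" by (simp add: M'_def)
    then show "M b c = (\<Sum>j<Suc r. (q(r := v)) j b * (q(r := v)) j c)"
      by (simp add: q2[OF bc])
  qed
qed

lemma full_rank_injective:
  fixes X :: "real mat"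
  assumes X: "X \<in> carrier_mat n k" and r: "vec_space.rank n X = k"
    and v: "v \<in> carrier_vec k" "X *\<^sub>v v = 0\<^sub>v n"
  shows "v = 0\<^sub>v k"
proof -
  interpret vec_space "TYPE(real)" n .
  \<comment> \<open>Repeated columns would leave fewer than \<open>k\<close> of them for an independent set.\<close>
  have dist: "distinct (cols X)"
  proof (rule ccontr)
    assume nd: "\<not> distinct (cols X)"
    obtain S where S: "maximal S (\<lambda>T. T \<subseteq> set (cols X) \<and> lin_indpt T)"
      using maximal_exists[of "(\<lambda>T. T \<subseteq> set (cols X) \<and> lin_indpt T)" "card (set (cols X))" "{}"]
      by (meson List.finite_set card_mono empty_iff empty_subsetI finite_lin_indpt2 rev_finite_subset)
    have "k = card S" using rank_card_indpt[OF X S] r by simp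
    also have "\<dots> \<le> card (set (cols X))"
      using S by (simp add: card_mono maximal_def)
    also have "\<dots> < length (cols X)"
      using nd card_length card_distinct le_neq_implies_less by blast
    finally show False using X by simp
  qed
  show ?thesis
    using lin_depI[OF X v(1) _ v(2) dist] full_rank_lin_indpt[OF X r dist] by blast
qed

lemma mult_mat_entry:
  fixes A B :: "real mat"
  assumes "A \<in> carrier_mat nr n" "B \<in> carrier_mat n nc" "a < nr" "b < nc"
  shows "(A * B) $$ (a, b) = (\<Sum>l<n. A $$ (a, l) * B $$ (l, b))"
  using assms by (simp add: scalar_prod_def atLeast0LessThan)

lemma mult_mat_vec_entry:
  fixes A :: "real mat"
  assumes "A \<in> carrier_mat nr n" "v \<in> carrier_vec n" "a < nr"
  shows "vec_index (A *\<^sub>v v) a = (\<Sum>l<n. A $$ (a, l) * vec_index v l)"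
  using assms by (simp add: scalar_prod_def atLeast0LessThan)

lemma scalar_prod_self:
  fixes v :: "real Matrix.vec"
  assumes "v \<in> carrier_vec n"
  shows "scalar_prod v v = (\<Sum>l<n. (vec_index v l)\<^sup>2)"
  using assms by (simp add: scalar_prod_def atLeast0LessThan power2_eq_square)

lemma mat_inverse_eq:
  fixes A :: "'a :: field mat"
  assumes A: "A \<in> carrier_mat n n" and B: "B \<in> carrier_mat n n" and AB: "A * B = 1\<^sub>m n"
  shows "mat_inverse A = Some B"
proof -
  have BA: "B * A = 1\<^sub>m n" by (rule mat_mult_left_right_inverse[OF A B AB])
  have "A \<in> Units (ring_mat TYPE('a) n ())"
    unfolding Units_def using A B AB BA by (auto simp: ring_mat_def)
  with mat_inverse(1)[OF A, where b = "()"] obtain C where inv: "mat_inverse A = Some C" by (cases "mat_inverse A") auto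
  from mat_inverse(2)[OF A inv] have CA: "C * A = 1\<^sub>m n" and C: "C \<in> carrier_mat n n" by auto
  have "C = C * (A * B)" unfolding AB using C by simp
  also have "\<dots> = C * A * B" by (rule assoc_mult_mat[OF C A B, symmetric])
  also have "\<dots> = B" unfolding CA using B by simp
  finally have "C = B" .
  with inv show ?thesis by simp
qed

text \<open>
  The Gram matrix has trivial kernel because \<open>v \<bullet> X\<^sup>T X v\<close> is the squared norm of \<open>X v\<close>.
\<close>

lemma gram_matrix_inverse:
  fixes X :: "real mat"
  assumes X: "X \<in> carrier_mat n k" and r: "vec_space.rank n X = k"
  obtains B where "B \<in> carrier_mat k k" "transpose_mat X * X * B = 1\<^sub>m k"
    "B * (transpose_mat X * X) = 1\<^sub>m k" "transpose_mat B = B"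
    "mat_inverse (transpose_mat X * X) = Some B"
proof -
  let ?G = "transpose_mat X * X"
  have Xt: "transpose_mat X \<in> carrier_mat k n" and G: "?G \<in> carrier_mat k k" using X by auto
  have "Determinant.det ?G \<noteq> 0"
  proof
    assume "Determinant.det ?G = 0"
    then obtain v where v: "v \<in> carrier_vec k" "v \<noteq> 0\<^sub>v k" "?G *\<^sub>v v = 0\<^sub>v k"
      using det_0_iff_vec_prod_zero_field[OF G] by auto
    have Xv: "X *\<^sub>v v \<in> carrier_vec n" using X v by simp
    have "scalar_prod (X *\<^sub>v v) (X *\<^sub>v v) = scalar_prod (transpose_mat X *\<^sub>v (X *\<^sub>v v)) v"
      using transpose_vec_mult_scalar[OF X v(1) Xv] by simp
    also have "transpose_mat X *\<^sub>v (X *\<^sub>v v) = 0\<^sub>v k"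
      using v Xt X by (simp flip: assoc_mult_mat_vec)
    finally have "(\<Sum>l<n. (vec_index (X *\<^sub>v v) l)\<^sup>2) = 0"
      using v by (simp add: scalar_prod_self[OF Xv])
    then have "X *\<^sub>v v = 0\<^sub>v n"
      using Xv X by (intro eq_vecI) (auto simp: sum_nonneg_eq_0_iff)
    with full_rank_injective[OF X r v(1)] v(2) show False by simp
  qed
  then have "?G \<in> Units (ring_mat TYPE(real) k ())"
    by (rule det_non_zero_imp_unit[OF G])
  with mat_inverse(1)[OF G, where b = "()"] obtain B where inv: "mat_inverse ?G = Some B"
    by (cases "mat_inverse ?G") auto
  from mat_inverse(2)[OF G inv] have B: "?G * B = 1\<^sub>m k" "B * ?G = 1\<^sub>m k" "B \<in> carrier_mat k k" by auto
  have Gt: "transpose_mat ?G = ?G"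
    using transpose_mult[OF Xt X] by simp
  have BtG: "transpose_mat B * ?G = 1\<^sub>m k"
    using transpose_mult[OF G B(3)] B(1) Gt by simp
  have Bt: "transpose_mat B \<in> carrier_mat k k" using B(3) by simp
  have "transpose_mat B = transpose_mat B * (?G * B)" unfolding B(1) using Bt by simp
  also have "\<dots> = transpose_mat B * ?G * B" by (rule assoc_mult_mat[OF Bt G B(3), symmetric])
  also have "\<dots> = B" unfolding BtG using B(3) by simp
  finally have Bs: "transpose_mat B = B" .
  show thesis by (rule that[OF B(3) B(1) B(2) Bs inv])
qed

text \<open>
  The residual is \<open>(I - R) u\<close> with \<open>R = X (X\<^sup>T X)\<^bsup>-1\<^esup> X\<^sup>T\<close>, and \<open>I - R\<close> is symmetric and
  idempotent with trace \<open>n - k\<close>; this yields the vectors with index below \<open>n - k\<close>. The \<open>i\<close>-th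
  estimation error is the scalar product of \<open>u\<close> with the \<open>i\<close>-th row \<open>a\<close> of \<open>(X\<^sup>T X)\<^bsup>-1\<^esup> X\<^sup>T\<close>,
  which lies in the kernel of \<open>I - R\<close> and has squared norm \<open>\<xi>\<^sup>2 / n\<close>; normalised, it is the vector
  with index \<open>n - k\<close>.
\<close>

lemma least_squares_orthonormal:
  fixes X :: "real mat"
  assumes X: "X \<in> carrier_mat n k" and r: "vec_space.rank n X = k" and kn: "k < n" and i: "i < k"
  obtains q :: "nat \<Rightarrow> nat \<Rightarrow> real"
  where "\<And>j j'. j < Suc (n - k) \<Longrightarrow> j' < Suc (n - k) \<Longrightarrow> (\<Sum>l<n. q j l * q j' l) = of_bool (j = j')"
    and "0 < xi X i"
    and "\<And>\<theta> y. \<theta> \<in> carrier_vec k \<Longrightarrow> y \<in> carrier_vec n \<Longrightarrow>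
          vec_index (ls_est X y) i = vec_index \<theta> i
            + xi X i / sqrt n * (\<Sum>l<n. q (n - k) l * vec_index (y - X *\<^sub>v \<theta>) l)"
    and "\<And>\<theta> y. \<theta> \<in> carrier_vec k \<Longrightarrow> y \<in> carrier_vec n \<Longrightarrow>
          scalar_prod (ls_resid X y) (ls_resid X y)
            = (\<Sum>j<n - k. (\<Sum>l<n. q j l * vec_index (y - X *\<^sub>v \<theta>) l)\<^sup>2)"
proof -
  let ?Xt = "transpose_mat X" let ?G = "?Xt * X"
  obtain B where B: "B \<in> carrier_mat k k" and GB: "?G * B = 1\<^sub>m k" and BG: "B * ?G = 1\<^sub>m k"
    and Bt: "transpose_mat B = B" and inv: "mat_inverse ?G = Some B"
    using gram_matrix_inverse[OF X r] .
  have Xt: "?Xt \<in> carrier_mat k n" and G: "?G \<in> carrier_mat k k" using X by auto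
  define C where "C = B * ?Xt"
  have C: "C \<in> carrier_mat k n" unfolding C_def using B Xt by simp
  have Ct: "transpose_mat C = X * B"
    unfolding C_def using transpose_mult[OF B Xt] Bt by simp
  have CX: "C * X = 1\<^sub>m k"
    unfolding C_def using B Xt X BG by (simp add: assoc_mult_mat[of _ k k _ n _ k])
  have CCt: "C * transpose_mat C = B"
    unfolding Ct using CX C X B by (simp flip: assoc_mult_mat[of _ k n _ k _ k])
  define R where "R = X * C"
  have R: "R \<in> carrier_mat n n" unfolding R_def using X C by simp
  have RR: "R * R = R"
  proof -
    have "R * R = X * (C * X * C)"
      unfolding R_def using X C by (simp add: assoc_mult_mat[of _ n k _ n _ n] assoc_mult_mat[of _ k n _ k _ n])
    then show ?thesis unfolding CX R_def using C by simp
  qed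
  have Rt: "transpose_mat R = R"
    unfolding R_def using transpose_mult[OF X C] Ct X B Xt C_def by (simp add: assoc_mult_mat[of _ n k _ k _ n])
  have Rsym: "R $$ (a, b) = R $$ (b, a)" if "a < n" "b < n" for a b
    using arg_cong[OF Rt, of "\<lambda>A. A $$ (a, b)"] R that by simp
  have RCt: "R * transpose_mat C = transpose_mat C"
    unfolding R_def using X B C CCt Ct by (simp add: assoc_mult_mat[of _ n k _ n _ k])
  define M where "M a b = of_bool (a = b) - R $$ (a, b)" for a b
  have trR: "(\<Sum>l<n. R $$ (l, l)) = real k"
  proof -
    have "(\<Sum>l<n. R $$ (l, l)) = (\<Sum>l<n. \<Sum>s<k. X $$ (l, s) * C $$ (s, l))"
      by (rule sum.cong[OF refl]) (simp only: R_def mult_mat_entry[OF X C] lessThan_iff)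
    also have "\<dots> = (\<Sum>s<k. \<Sum>l<n. C $$ (s, l) * X $$ (l, s))"
      by (subst sum.swap) (simp add: mult.commute)
    also have "\<dots> = (\<Sum>s<k. (C * X) $$ (s, s))"
      by (rule sum.cong[OF refl]) (simp only: mult_mat_entry[OF C X] lessThan_iff)
    also have "\<dots> = real k" unfolding CX by simp
    finally show ?thesis .
  qed
  have "\<exists>q. (\<forall>j<n - k. \<forall>j'<n - k. (\<Sum>l<n. q j l * q j' l) = of_bool (j = j')) \<and>
             (\<forall>a<n. \<forall>b<n. M a b = (\<Sum>j<n - k. q j a * q j b))"
  proof (rule symmetric_idempotent_orthonormal)
    show "M a b = M b a" if "a < n" "b < n" for a b
      using Rsym[OF that] by (auto simp: M_def)
    show "(\<Sum>l<n. M a l * M l b) = M a b" if ab: "a < n" "b < n" for a b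
    proof -
      have "(\<Sum>l<n. M a l * M l b) = (\<Sum>l<n. (if a = l then of_bool (l = b) - R $$ (l, b) else 0)
          - (if l = b then R $$ (a, l) else 0) + R $$ (a, l) * R $$ (l, b))"
        by (intro sum.cong refl) (auto simp: M_def algebra_simps)
      also have "\<dots> = M a b - R $$ (a, b) + (R * R) $$ (a, b)"
        using ab mult_mat_entry[OF R R ab] by (simp add: sum.distrib sum_subtractf M_def)
      finally show ?thesis unfolding RR by simp
    qed
    show "(\<Sum>l<n. M l l) = real (n - k)"
      using trR kn by (simp add: M_def sum_subtractf)
  qed
  then obtain q where
    q1: "\<And>j j'. j < n - k \<Longrightarrow> j' < n - k \<Longrightarrow> (\<Sum>l<n. q j l * q j' l) = of_bool (j = j')" and
    q2: "\<And>a b. a < n \<Longrightarrow> b < n \<Longrightarrow> M a b = (\<Sum>j<n - k. q j a * q j b)" by blast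
  have norm_M: "(\<Sum>a<n. (\<Sum>b<n. M a b * u b)\<^sup>2) = (\<Sum>j<n - k. (\<Sum>l<n. q j l * u l)\<^sup>2)" for u
  proof -
    have "(\<Sum>b<n. M a b * u b) = (\<Sum>j<n - k. (\<Sum>l<n. q j l * u l) * q j a)" if "a < n" for a
    proof -
      have "(\<Sum>b<n. M a b * u b) = (\<Sum>b<n. \<Sum>j<n - k. q j b * u b * q j a)"
        by (intro sum.cong refl) (simp add: q2 that sum_distrib_left sum_distrib_right ac_simps)
      then show ?thesis by (subst (asm) sum.swap) (simp add: sum_distrib_right)
    qed
    then have "(\<Sum>a<n. (\<Sum>b<n. M a b * u b)\<^sup>2) = (\<Sum>a<n. (\<Sum>j<n - k. (\<Sum>l<n. q j l * u l) * q j a)\<^sup>2)"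
      by simp
    also have "\<dots> = (\<Sum>j<n - k. (\<Sum>l<n. q j l * u l)\<^sup>2)"
      by (rule sum_orthonormal_square) (rule q1)
    finally show ?thesis .
  qed
  define a where "a l = C $$ (i, l)" for l
  have a_sq: "(\<Sum>l<n. (a l)\<^sup>2) = B $$ (i, i)"
  proof -
    have "B $$ (i, i) = (C * transpose_mat C) $$ (i, i)" by (simp only: CCt)
    also have "\<dots> = (\<Sum>l<n. C $$ (i, l) * transpose_mat C $$ (l, i))"
      by (rule mult_mat_entry[OF C _ i i]) (use C in simp)
    also have "\<dots> = (\<Sum>l<n. (a l)\<^sup>2)"
      by (rule sum.cong[OF refl]) (use C i in \<open>simp add: a_def power2_eq_square\<close>)
    finally show ?thesis by simp
  qed
  have "(C * X) $$ (i, i) = (\<Sum>l<n. a l * X $$ (l, i))"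
    unfolding a_def by (rule mult_mat_entry[OF C X i i])
  then have aX: "(\<Sum>l<n. a l * X $$ (l, i)) = 1" using i by (simp add: CX)
  have "\<exists>l<n. a l \<noteq> 0"
  proof (rule ccontr)
    assume "\<not> (\<exists>l<n. a l \<noteq> 0)"
    then have "(\<Sum>l<n. a l * X $$ (l, i)) = 0" by simp
    with aX show False by simp
  qed
  then have Bpos: "B $$ (i, i) > 0"
    unfolding a_sq[symmetric] by (auto intro: sum_pos2)
  have Ma: "(\<Sum>b<n. M c b * a b) = 0" if c: "c < n" for c
  proof -
    have "(\<Sum>b<n. M c b * a b) = (\<Sum>b<n. (if c = b then a b else 0) - R $$ (c, b) * transpose_mat C $$ (b, i))"
      using C i by (intro sum.cong refl) (auto simp: M_def a_def algebra_simps)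
    also have "\<dots> = a c - (R * transpose_mat C) $$ (c, i)"
      using mult_mat_entry[OF R, of "transpose_mat C" k c i] C c i by (simp add: sum_subtractf)
    also have "\<dots> = 0" unfolding RCt using C c i by (simp add: a_def)
    finally show ?thesis .
  qed
  have qa: "(\<Sum>l<n. q j l * a l) = 0" if "j < n - k" for j
    using norm_M[of a] that by (simp add: Ma sum_nonneg_eq_0_iff)
  have n0: "real n > 0" using kn by simp
  have "mat_inverse ((1 / real n) \<cdot>\<^sub>m ?G) = Some (real n \<cdot>\<^sub>m B)"
  proof (rule mat_inverse_eq[of _ k])
    show "(1 / real n) \<cdot>\<^sub>m ?G * (real n \<cdot>\<^sub>m B) = 1\<^sub>m k"
      using G B GB n0 by (intro eq_matI) (auto simp: mult_smult_distrib[of _ k k _ k] mult_smult_assoc_mat[of _ k k _ k])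
  qed (use G B in auto)
  then have xi: "xi X i = sqrt (real n * B $$ (i, i))"
    unfolding xi_def using X B i by simp
  then have xi_pos: "0 < xi X i" using Bpos n0 by simp
  have xn: "xi X i / sqrt n = sqrt (B $$ (i, i))"
    unfolding xi using n0 by (simp add: real_sqrt_mult)
  define Q where "Q = q(n - k := \<lambda>l. a l / sqrt (B $$ (i, i)))"
  have est: "ls_est X y = \<theta> + C *\<^sub>v (y - X *\<^sub>v \<theta>)"
    if \<theta>: "\<theta> \<in> carrier_vec k" and y: "y \<in> carrier_vec n" for \<theta> y
  proof -
    have "ls_est X y = C *\<^sub>v y"
      unfolding ls_est_def inv C_def using B Xt y by simp
    moreover have "C *\<^sub>v (y - X *\<^sub>v \<theta>) = C *\<^sub>v y - (C * X) *\<^sub>v \<theta>"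
      using C X \<theta> y by (simp add: mult_minus_distrib_mat_vec[OF C])
    moreover have "(C * X) *\<^sub>v \<theta> = \<theta>" unfolding CX using \<theta> by simp
    moreover have "C *\<^sub>v y \<in> carrier_vec k" using C y by simp
    ultimately show ?thesis using \<theta> C by (intro eq_vecI) auto
  qed
  show thesis
  proof (rule that[of Q])
    show "(\<Sum>l<n. Q j l * Q j' l) = of_bool (j = j')" if "j < Suc (n - k)" "j' < Suc (n - k)" for j j'
    proof -
      have "(\<Sum>l<n. a l * q j l) = 0" if "j < n - k" for j
        using qa[OF that] by (simp add: mult.commute)
      moreover have "(\<Sum>l<n. a l * a l) = B $$ (i, i)"
        using a_sq by (simp add: power2_eq_square)
      ultimately show ?thesis
        using that Bpos by (auto simp: Q_def less_Suc_eq q1 qa simp flip: sum_divide_distrib)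
    qed
    show "0 < xi X i" by (rule xi_pos)
    fix \<theta> y :: "real Matrix.vec" assume \<theta>: "\<theta> \<in> carrier_vec k" and y: "y \<in> carrier_vec n"
    define u where "u = y - X *\<^sub>v \<theta>"
    have u: "u \<in> carrier_vec n" unfolding u_def using X \<theta> y by simp
    have "vec_index (ls_est X y) i = vec_index \<theta> i + (\<Sum>l<n. a l * vec_index u l)"
      using est[OF \<theta> y] \<theta> C i mult_mat_vec_entry[OF C u i] by (simp add: a_def flip: u_def)
    then show "vec_index (ls_est X y) i = vec_index \<theta> i
            + xi X i / sqrt n * (\<Sum>l<n. Q (n - k) l * vec_index (y - X *\<^sub>v \<theta>) l)"
      unfolding xn u_def[symmetric] using Bpos by (simp add: Q_def flip: sum_divide_distrib)
    have res: "ls_resid X y = u - R *\<^sub>v u"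
    proof -
      have "X *\<^sub>v ls_est X y = X *\<^sub>v \<theta> + R *\<^sub>v u"
        unfolding est[OF \<theta> y] u_def[symmetric] R_def using X C \<theta> u
        by (simp add: mult_add_distrib_mat_vec[OF X])
      then show ?thesis unfolding ls_resid_def u_def using X \<theta> y R by (intro eq_vecI) auto
    qed
    have "vec_index (ls_resid X y) c = (\<Sum>b<n. M c b * vec_index u b)" if c: "c < n" for c
    proof -
      have "(\<Sum>b<n. M c b * vec_index u b) = (\<Sum>b<n. (if c = b then vec_index u b else 0) - R $$ (c, b) * vec_index u b)"
        by (intro sum.cong refl) (auto simp: M_def algebra_simps)
      then show ?thesis
        unfolding res using mult_mat_vec_entry[OF R u c] u R c by (simp add: sum_subtractf)
    qed
    then have "scalar_prod (ls_resid X y) (ls_resid X y) = (\<Sum>c<n. (\<Sum>b<n. M c b * vec_index u b)\<^sup>2)"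
      using scalar_prod_self[of "ls_resid X y" n] res u R by simp
    then show "scalar_prod (ls_resid X y) (ls_resid X y)
            = (\<Sum>j<n - k. (\<Sum>l<n. Q j l * vec_index (y - X *\<^sub>v \<theta>) l)\<^sup>2)"
      unfolding norm_M u_def[symmetric] by (simp add: Q_def)
  qed
qed

section \<open>The scaled chi distribution\<close>

abbreviation (input) stdN :: "real measure" where "stdN \<equiv> std_normal_distribution"

lemma measurable_stdN_component:
  "j \<in> {..<p} \<Longrightarrow> (\<lambda>z. z j) \<in> borel_measurable (PiM {..<p} (\<lambda>_. stdN))"
  using measurable_component_singleton[of j "{..<p}" "\<lambda>_. stdN"] by simp

text \<open>
  For positive \<open>m\<close>, the distribution whose density is \<open>rho m\<close>.
\<close>

definition scaled_chi :: "nat \<Rightarrow> real measure" where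
  "scaled_chi m = distr (chi_square_distribution m) borel (\<lambda>x. sqrt x / sqrt (real m))"

lemma scaled_chi_eq:
  "scaled_chi m = distr (PiM {..<m} (\<lambda>_. stdN)) borel (\<lambda>z. sqrt ((\<Sum>j<m. (z j)\<^sup>2) / real m))"
proof -
  note measurable_stdN_component [measurable]
  show ?thesis
    unfolding scaled_chi_def chi_square_distribution_def
    by (subst distr_distr) (auto simp: comp_def real_sqrt_divide)
qed

lemma real_distribution_scaled_chi: "real_distribution (scaled_chi m)"
  unfolding scaled_chi_def chi_square_distribution_def
proof (intro prob_space.real_distribution_distr prob_space.prob_space_distr)
  show "prob_space (PiM {..<m} (\<lambda>_. stdN))"
    by (intro prob_space_PiM prob_space_normal_density) simp
  note measurable_stdN_component [measurable]
  show "(\<lambda>z. \<Sum>j<m. (z j)\<^sup>2) \<in> borel_measurable (PiM {..<m} (\<lambda>_. stdN))"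
    by measurable
qed simp

lemma AE_scaled_chi_nonneg: "AE s in scaled_chi m. 0 \<le> s"
proof -
  note measurable_stdN_component [measurable]
  show ?thesis
    unfolding scaled_chi_eq by (subst AE_distr_iff) (auto intro!: AE_I2 divide_nonneg_nonneg sum_nonneg)
qed

lemma distr_PiM_Suc:
  fixes N :: "real measure"
  assumes "prob_space N"
  shows "distr (N \<Otimes>\<^sub>M PiM {..<p} (\<lambda>_. N)) (PiM {..<Suc p} (\<lambda>_. N)) (\<lambda>(x, z). z(p := x)) = PiM {..<Suc p} (\<lambda>_. N)"
  using distr_pair_PiM_eq_PiM[of "{..<p}" "\<lambda>_. N" p] assms by (simp add: lessThan_Suc)

text \<open>
  Away from \<open>x = 0\<close> the map \<open>x \<mapsto> sqrt ((x\<^sup>2 + r) / c)\<close> has the two differentiable local inverses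
  \<open>a \<mapsto> \<plusminus> sqrt (c a\<^sup>2 - r)\<close>, and differentiable images of null sets are null.
\<close>

lemma null_sets_chi_slice:
  assumes A: "A \<in> null_sets lborel" and c: "0 < c" and r: "0 \<le> r"
  shows "{x::real. sqrt ((x\<^sup>2 + r) / c) \<in> A} \<in> null_sets lborel"
proof -
  let ?S = "{x::real. sqrt ((x\<^sup>2 + r) / c) \<in> A}"
  have [measurable]: "A \<in> sets borel" using A by auto
  have negA: "negligible A"
    using null_sets_completionI[OF A] by (simp add: negligible_iff_null_sets)
  \<comment> \<open>The zeros of the local inverses, where they are not differentiable, are left out; these are
    covered by \<open>x = 0\<close>.\<close>
  define A' where "A' = A \<inter> {a. c * a\<^sup>2 - r > 0}"
  let ?f = "\<lambda>a. sqrt (c * a\<^sup>2 - r)"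
  have diff: "?f differentiable_on A'" "(\<lambda>a. - ?f a) differentiable_on A'"
  proof -
    have "?f differentiable (at a within A')" if "a \<in> A'" for a
    proof (rule differentiable_at_withinI[OF differentiableI[OF has_field_derivative_imp_has_derivative]])
      show "(?f has_real_derivative (inverse (sqrt (c * a\<^sup>2 - r)) / 2 * (c * (2 * a)))) (at a)"
        using that by (auto intro!: derivative_eq_intros simp: A'_def)
    qed
    then show "?f differentiable_on A'" by (auto simp: differentiable_on_def)
    then show "(\<lambda>a. - ?f a) differentiable_on A'" by (rule differentiable_on_minus)
  qed
  have negA': "negligible A'" using negA unfolding A'_def by (rule negligible_subset) auto
  have "negligible (?f ` A')" "negligible ((\<lambda>a. - ?f a) ` A')"
    by (rule negligible_differentiable_image_negligible[OF _ negA'] ; use diff in simp)+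
  then have "negligible ({0} \<union> ?f ` A' \<union> (\<lambda>a. - ?f a) ` A')"
    by (intro negligible_Un negligible_sing)
  moreover have "?S \<subseteq> {0} \<union> ?f ` A' \<union> (\<lambda>a. - ?f a) ` A'"
  proof
    fix x assume x: "x \<in> ?S"
    show "x \<in> {0} \<union> ?f ` A' \<union> (\<lambda>a. - ?f a) ` A'"
    proof (cases "x = 0")
      case False
      define a where "a = sqrt ((x\<^sup>2 + r) / c)"
      have a2: "c * a\<^sup>2 - r = x\<^sup>2" using False c r by (simp add: a_def)
      moreover have "c * a\<^sup>2 - r > 0" using a2 False zero_less_power2[of x] by linarith
      moreover have "a \<in> A" using x by (simp add: a_def)
      ultimately have "a \<in> A'" unfolding A'_def by blast
      moreover have "?f a = \<bar>x\<bar>" unfolding a2 by simp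
      ultimately show ?thesis by (cases "x \<ge> 0") force+
    qed simp
  qed
  ultimately have "negligible ?S" by (rule negligible_subset)
  moreover have "?S \<in> sets borel" by measurable
  ultimately show ?thesis
    by (simp add: negligible_iff_null_sets null_sets_completion_iff)
qed

text \<open>
  This makes the Radon-Nikodym derivative in the definition of \<open>rho\<close> a density. With all but one of
  the normal coordinates fixed, the remaining one already avoids a null set almost surely.
\<close>

lemma absolutely_continuous_scaled_chi:
  assumes "0 < m"
  shows "absolutely_continuous lborel (scaled_chi m)"
  unfolding absolutely_continuous_def
proof
  fix A :: "real set" assume A: "A \<in> null_sets lborel"
  then have Ab [measurable]: "A \<in> sets borel" by auto
  obtain p where m: "m = Suc p" using assms by (cases m) auto
  interpret N: prob_space stdN by (rule prob_space_normal_density) simp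
  let ?P = "PiM {..<p} (\<lambda>_. stdN)" and ?PS = "PiM {..<Suc p} (\<lambda>_. stdN)"
  interpret P: prob_space ?P by (intro prob_space_PiM N.prob_space_axioms)
  interpret NP: pair_prob_space stdN ?P by unfold_locales
  note measurable_stdN_component [measurable]
  have upd: "(\<lambda>(x, z). z(p := x)) \<in> stdN \<Otimes>\<^sub>M ?P \<rightarrow>\<^sub>M ?PS"
    unfolding lessThan_Suc split_beta by (rule measurable_fun_upd[where J = "{..<p}"]) auto
  have law: "scaled_chi m = distr (stdN \<Otimes>\<^sub>M ?P) borel (\<lambda>(x, z). sqrt ((x\<^sup>2 + (\<Sum>j<p. (z j)\<^sup>2)) / real m))"
  proof -
    have "scaled_chi m = distr (distr (stdN \<Otimes>\<^sub>M ?P) ?PS (\<lambda>(x, z). z(p := x))) borel (\<lambda>z. sqrt ((\<Sum>j<m. (z j)\<^sup>2) / real m))"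
      unfolding scaled_chi_eq distr_PiM_Suc[OF N.prob_space_axioms] by (simp add: m)
    also have "\<dots> = distr (stdN \<Otimes>\<^sub>M ?P) borel (\<lambda>(x, z). sqrt ((x\<^sup>2 + (\<Sum>j<p. (z j)\<^sup>2)) / real m))"
      by (subst distr_distr[OF _ upd]) (auto simp: m comp_def split_beta' add.commute)
    finally show ?thesis .
  qed
  define B where "B = {(x, z). sqrt ((x\<^sup>2 + (\<Sum>j<p. (z j)\<^sup>2)) / real m) \<in> A} \<inter> space (stdN \<Otimes>\<^sub>M ?P)"
  have B: "B \<in> sets (stdN \<Otimes>\<^sub>M ?P)"
    unfolding B_def by measurable
  have "emeasure (scaled_chi m) A = emeasure (stdN \<Otimes>\<^sub>M ?P) B"
    unfolding law by (subst emeasure_distr) (auto simp: B_def intro!: arg_cong2[where f = emeasure])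
  also have "\<dots> = (\<integral>\<^sup>+ z. emeasure stdN ((\<lambda>x. (x, z)) -` B) \<partial>?P)"
    by (rule NP.emeasure_pair_measure_alt2[OF B])
  also have "\<dots> = (\<integral>\<^sup>+ z. 0 \<partial>?P)"
  proof (rule nn_integral_cong)
    fix z assume "z \<in> space ?P"
    then have "(\<lambda>x. (x, z)) -` B = {x. sqrt ((x\<^sup>2 + (\<Sum>j<p. (z j)\<^sup>2)) / real m) \<in> A}"
      by (auto simp: B_def space_pair_measure)
    also have "\<dots> \<in> null_sets lborel"
      using assms by (intro null_sets_chi_slice A) (auto intro: sum_nonneg)
    finally show "emeasure stdN ((\<lambda>x. (x, z)) -` B) = 0"
      using absolutely_continuousI_density[of std_normal_density lborel]
      by (auto simp: absolutely_continuous_def)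
  qed
  finally have "emeasure (scaled_chi m) A = 0" by simp
  then show "A \<in> null_sets (scaled_chi m)"
    using A by (auto simp: null_sets_def scaled_chi_def)
qed

lemma LBINT_rho:
  assumes m: "0 < m" and [measurable]: "f \<in> borel_measurable borel"
  shows "(LBINT s:{0..}. f s * rho m s) = (LINT s|scaled_chi m. f s)"
proof -
  let ?g = "RN_deriv lborel (scaled_chi m)"
  interpret real_distribution "scaled_chi m" by (rule real_distribution_scaled_chi)
  note ac = absolutely_continuous_scaled_chi[OF m]
  have fin: "AE s in lborel. ?g s \<noteq> \<infinity>"
    by (rule sigma_finite_measure.RN_deriv_finite[OF sigma_finite_lborel _ ac]) (unfold_locales, simp)
  have "density lborel ?g = scaled_chi m"
    by (rule sigma_finite_measure.density_RN_deriv[OF sigma_finite_lborel ac]) simp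
  moreover have "density lborel ?g = density lborel (\<lambda>s. ennreal (enn2real (?g s)))"
    by (rule density_cong) (use fin in \<open>auto simp: less_top\<close>)
  ultimately have dens: "scaled_chi m = density lborel (\<lambda>s. ennreal (enn2real (?g s)))" by simp
  have "(LINT s|scaled_chi m. f s) = (LINT s|scaled_chi m. indicator {0..} s * f s)"
    by (rule integral_cong_AE) (use AE_scaled_chi_nonneg[of m] in auto)
  also have "\<dots> = (LINT s|density lborel (\<lambda>s. ennreal (enn2real (?g s))). indicator {0..} s * f s)"
    by (subst dens) (rule refl)
  also have "\<dots> = (LBINT s. enn2real (?g s) *\<^sub>R (indicator {0..} s * f s))"
    by (subst integral_density) auto
  also have "\<dots> = (LBINT s:{0..}. f s * rho m s)"
    unfolding set_lebesgue_integral_def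
    by (rule Bochner_Integration.integral_cong) (auto simp: rho_def scaled_chi_def indicator_def)
  finally show ?thesis by simp
qed

text \<open>
  \<open>\<bar>s - 1\<bar> \<le> \<bar>s\<^sup>2 - 1\<bar>\<close> for \<open>s \<ge> 0\<close>, so the second moment about 1 is at most the variance of the mean
  of \<open>m\<close> independent squares of standard normal variables, each of which has variance 2.
\<close>

lemma scaled_chi_variance:
  assumes m: "0 < m"
  shows "integrable (scaled_chi m) (\<lambda>s. (s - 1)\<^sup>2)" "(LINT s|scaled_chi m. (s - 1)\<^sup>2) \<le> 2 / m"
proof -
  interpret N: prob_space stdN by (rule prob_space_normal_density) simp
  interpret P: product_prob_space "\<lambda>_::nat. stdN" by unfold_locales
  let ?P = "PiM {..<m} (\<lambda>_. stdN)"
  have N1: "measure stdN UNIV = 1" using N.prob_space by simp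
  define g where "g x = x\<^sup>2 - 1" for x :: real
  define Q where "Q z = (\<Sum>j<m. (z j)\<^sup>2)" for z :: "nat \<Rightarrow> real"
  note measurable_stdN_component [measurable]
  have Qm [measurable]: "Q \<in> borel_measurable ?P" unfolding Q_def[abs_def] by measurable
  have i2: "integrable stdN (\<lambda>x. x\<^sup>2)" and i4: "integrable stdN (\<lambda>x. x^4)"
    by (rule integrable_std_normal_distribution_moment)+
  have e2: "(LINT x|stdN. x\<^sup>2) = 1"
    using std_normal_distribution_even_moments[of 1] by (simp add: fact_numeral)
  have e4: "(LINT x|stdN. x^4) = 3"
    using std_normal_distribution_even_moments[of 2] by (simp add: fact_numeral)
  have gi: "integrable stdN g" and g0: "(LINT x|stdN. g x) = 0"
    unfolding g_def[abs_def] using i2 by (simp_all add: e2 N1)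
  have gg: "g x * g x = x^4 - 2 * x\<^sup>2 + 1" for x
    by (simp add: g_def power4_eq_xxxx power2_eq_square algebra_simps)
  have ggi: "integrable stdN (\<lambda>x. g x * g x)" and gg2: "(LINT x|stdN. g x * g x) = 2"
    unfolding gg using i2 i4 by (simp_all add: e2 e4 N1)
  \<comment> \<open>One factor per coordinate of the product measure, so that the product over all coordinates is
    \<open>g (z i) * g (z j)\<close> also when \<open>i = j\<close>.\<close>
  define h where "h i j l x = (if l = i then g x else 1) * (if l = j then g x else 1)" for i j l :: nat and x
  have hi: "integrable stdN (h i j l)" for i j l
    unfolding h_def[abs_def] using gi ggi by (cases "l = i"; cases "l = j") auto
  have hprod: "(\<Prod>l<m. h i j l (z l)) = g (z i) * g (z j)" if "i < m" "j < m" for i j z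
    using that by (simp add: h_def prod.distrib prod.delta)
  have int: "integrable ?P (\<lambda>z. g (z i) * g (z j))" if "i < m" "j < m" for i j
    using P.product_integrable_prod[of "{..<m}" "h i j"] hi hprod[OF that] by simp
  have cov: "(LINT z|?P. g (z i) * g (z j)) = (if i = j then 2 else 0)" if ij: "i < m" "j < m" for i j
  proof -
    have "(LINT z|?P. g (z i) * g (z j)) = (\<Prod>l<m. LINT x|stdN. h i j l x)"
      using P.product_integral_prod[of "{..<m}" "h i j"] hi hprod[OF ij] by simp
    also have "\<dots> = (if i = j then 2 else 0)"
    proof (cases "i = j")
      case True
      have "(\<Prod>l<m. LINT x|stdN. h i j l x) = (\<Prod>l<m. if l = i then 2 else 1)"
        by (rule prod.cong) (auto simp: h_def True gg2 N1)
      with True ij show ?thesis by (simp add: prod.delta)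
    next
      case False
      have "(LINT x|stdN. h i j i x) = 0" using False g0 by (simp add: h_def)
      then show ?thesis using False ij by (auto intro: prod_zero)
    qed
    finally show ?thesis .
  qed
  have sq: "(Q z / m - 1)\<^sup>2 = (\<Sum>i<m. \<Sum>j<m. g (z i) * g (z j)) / (real m)\<^sup>2" for z
  proof -
    have "Q z / m - 1 = (\<Sum>j<m. g (z j)) / m"
      using m by (simp add: Q_def g_def sum_subtractf diff_divide_distrib)
    then show ?thesis by (simp add: power_divide power2_eq_square sum_product)
  qed
  have sqi: "integrable ?P (\<lambda>z. (Q z / m - 1)\<^sup>2)"
    unfolding sq by (intro integrable_divide Bochner_Integration.integrable_sum int) auto
  have sqv: "(LINT z|?P. (Q z / m - 1)\<^sup>2) = 2 / m"
  proof -
    have "(LINT z|?P. (\<Sum>i<m. \<Sum>j<m. g (z i) * g (z j))) = (\<Sum>i<m. LINT z|?P. (\<Sum>j<m. g (z i) * g (z j)))"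
      by (rule Bochner_Integration.integral_sum) (auto intro!: Bochner_Integration.integrable_sum int)
    also have "\<dots> = (\<Sum>i<m. \<Sum>j<m. (LINT z|?P. g (z i) * g (z j)))"
      by (intro sum.cong refl Bochner_Integration.integral_sum) (auto intro: int)
    finally have "(LINT z|?P. (Q z / m - 1)\<^sup>2) = (\<Sum>i<m. \<Sum>j<m. (LINT z|?P. g (z i) * g (z j))) / (real m)\<^sup>2"
      unfolding sq by simp
    also have "\<dots> = (\<Sum>i<m. \<Sum>j<m. if i = j then 2 else 0) / (real m)\<^sup>2"
      by (simp add: cov)
    also have "\<dots> = 2 / m" using m by (simp add: power2_eq_square)
    finally show ?thesis .
  qed
  have le: "(sqrt (Q z / m) - 1)\<^sup>2 \<le> (Q z / m - 1)\<^sup>2" for z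
  proof -
    define s where "s = sqrt (Q z / m)"
    have s: "0 \<le> s" "s\<^sup>2 = Q z / m" by (simp_all add: s_def Q_def sum_nonneg)
    have "\<bar>s - 1\<bar> * 1 \<le> \<bar>s - 1\<bar> * \<bar>s + 1\<bar>" using s by (intro mult_left_mono) auto
    also have "\<dots> = \<bar>Q z / m - 1\<bar>" unfolding s(2)[symmetric] abs_mult[symmetric]
      by (simp add: algebra_simps power2_eq_square)
    finally show ?thesis by (simp add: s_def abs_le_square_iff)
  qed
  have Si: "integrable ?P (\<lambda>z. (sqrt (Q z / m) - 1)\<^sup>2)"
    by (rule Bochner_Integration.integrable_bound[OF sqi]) (use le in auto)
  show "integrable (scaled_chi m) (\<lambda>s. (s - 1)\<^sup>2)"
    unfolding scaled_chi_eq Q_def[symmetric] using Si by (simp add: integrable_distr_eq)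
  have "(LINT s|scaled_chi m. (s - 1)\<^sup>2) = (LINT z|?P. (sqrt (Q z / m) - 1)\<^sup>2)"
    unfolding scaled_chi_eq Q_def[symmetric] by (simp add: integral_distr)
  also have "\<dots> \<le> (LINT z|?P. (Q z / m - 1)\<^sup>2)"
    by (rule integral_mono[OF Si sqi le])
  finally show "(LINT s|scaled_chi m. (s - 1)\<^sup>2) \<le> 2 / m" by (simp add: sqv)
qed

lemma scaled_chi_pair:
  "distr (PiM {..<Suc m} (\<lambda>_. stdN)) (borel \<Otimes>\<^sub>M borel) (\<lambda>z. (sqrt ((\<Sum>j<m. (z j)\<^sup>2) / real m), z m))
    = scaled_chi m \<Otimes>\<^sub>M stdN"
proof -
  interpret N: real_distribution stdN by (rule real_dist_normal_dist)
  let ?P = "PiM {..<m} (\<lambda>_. stdN)" and ?PS = "PiM {..<Suc m} (\<lambda>_. stdN)"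
  let ?S = "\<lambda>z. sqrt ((\<Sum>j<m. (z j)\<^sup>2) / real m)"
  interpret P: prob_space ?P by (intro prob_space_PiM N.prob_space_axioms)
  interpret NP: pair_prob_space stdN ?P by unfold_locales
  note measurable_stdN_component [measurable]
  have upd: "(\<lambda>(x, z). z(m := x)) \<in> stdN \<Otimes>\<^sub>M ?P \<rightarrow>\<^sub>M ?PS"
    unfolding lessThan_Suc split_beta by (rule measurable_fun_upd[where J = "{..<m}"]) auto
  have Sm: "(\<lambda>z. (?S z, z m)) \<in> ?PS \<rightarrow>\<^sub>M borel \<Otimes>\<^sub>M borel" by measurable
  have "distr ?PS (borel \<Otimes>\<^sub>M borel) (\<lambda>z. (?S z, z m))
      = distr (distr (stdN \<Otimes>\<^sub>M ?P) ?PS (\<lambda>(x, z). z(m := x))) (borel \<Otimes>\<^sub>M borel) (\<lambda>z. (?S z, z m))"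
    unfolding distr_PiM_Suc[OF N.prob_space_axioms] ..
  also have "\<dots> = distr (stdN \<Otimes>\<^sub>M ?P) (borel \<Otimes>\<^sub>M borel) (\<lambda>(x, z). (?S z, x))"
    by (subst distr_distr[OF Sm upd]) (auto simp: comp_def split_beta')
  also have "\<dots> = distr (distr (?P \<Otimes>\<^sub>M stdN) (stdN \<Otimes>\<^sub>M ?P) (\<lambda>(z, x). (x, z))) (borel \<Otimes>\<^sub>M borel) (\<lambda>(x, z). (?S z, x))"
    by (subst NP.distr_pair_swap) (rule refl)
  also have "\<dots> = distr (?P \<Otimes>\<^sub>M stdN) (borel \<Otimes>\<^sub>M borel) (\<lambda>(z, x). (?S z, x))"
    by (subst distr_distr) (auto simp: comp_def split_beta')
  also have "\<dots> = distr ?P borel ?S \<Otimes>\<^sub>M distr stdN borel (\<lambda>x. x)"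
    by (rule pair_measure_distr[symmetric])
       (auto intro!: prob_space_imp_sigma_finite N.prob_space_distr)
  also have "\<dots> = scaled_chi m \<Otimes>\<^sub>M stdN"
    by (simp add: scaled_chi_eq distr_id2)
  finally show ?thesis .
qed

section \<open>The exact law of the thresholding estimator\<close>

text \<open>
  At infinite \<open>\<nu>\<close> the condition always holds, so the value \<open>real_of_ereal (- \<nu>)\<close> only occurs at
  finite \<open>\<nu>\<close>.
\<close>

definition thresholded :: "ereal \<Rightarrow> real \<Rightarrow> real \<Rightarrow> real" where
  "thresholded \<nu> c w = (if \<bar>ereal w + \<nu>\<bar> > ereal c then w else real_of_ereal (- \<nu>))"

definition ht_law :: "real measure \<Rightarrow> ereal \<Rightarrow> real \<Rightarrow> real measure" where
  "ht_law \<mu> \<nu> e = distr (\<mu> \<Otimes>\<^sub>M stdN) borel (\<lambda>(s, w). thresholded \<nu> (s * e) w)"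

lemma thresholded_infinite: "\<bar>\<nu>\<bar> = \<infinity> \<Longrightarrow> thresholded \<nu> c w = w"
  by (cases \<nu>) (auto simp: thresholded_def)

lemma thresholded_real: "thresholded (ereal r) c w = (if \<bar>w + r\<bar> > c then w else - r)"
  by (simp add: thresholded_def)

lemma measurable_thresholded [measurable]:
  assumes [measurable]: "f \<in> borel_measurable M" "g \<in> borel_measurable M"
  shows "(\<lambda>x. thresholded \<nu> (f x) (g x)) \<in> borel_measurable M"
  unfolding thresholded_def by measurable

lemma sets_ht_law [simp, measurable_cong]: "sets (ht_law \<mu> \<nu> e) = sets borel"
  by (simp add: ht_law_def)

lemma real_distribution_ht_law:
  assumes "real_distribution \<mu>"
  shows "real_distribution (ht_law \<mu> \<nu> e)"
proof -
  interpret \<mu>: real_distribution \<mu> by fact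
  interpret N: real_distribution stdN by (rule real_dist_normal_dist)
  interpret P: pair_prob_space \<mu> stdN by unfold_locales
  show ?thesis unfolding ht_law_def by (rule P.real_distribution_distr) measurable
qed

text \<open>
  Both sides of the thresholding condition and the estimate itself carry the factor
  \<open>\<sigma> \<xi> / sqrt n\<close>, named \<open>a\<close> in the proof, which the scaling cancels.
\<close>

theorem distr_hard_thr_est:
  fixes X :: "real mat"
  assumes X: "X \<in> carrier_mat n k" and rank: "vec_space.rank n X = k" and kn: "k < n" and i: "i < k"
    and \<theta>: "\<theta> \<in> carrier_vec k" and \<sigma>: "0 < \<sigma>" and model: "gaussian_linear_model M X \<theta> \<sigma> Y"
  shows "distr M borel (\<lambda>\<omega>. inverse \<sigma> * (sqrt (real n) / xi X i) *
            (hard_thr_est X \<eta> i (Y \<omega>) - vec_index \<theta> i))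
       = ht_law (scaled_chi (n - k)) (ereal (sqrt (real n) * vec_index \<theta> i / (\<sigma> * xi X i))) (sqrt (real n) * \<eta>)"
proof -
  define m where "m = n - k"
  have m: "0 < m" using kn by (simp add: m_def)
  obtain q where
    q: "\<And>j j'. j < Suc m \<Longrightarrow> j' < Suc m \<Longrightarrow> (\<Sum>l<n. q j l * q j' l) = of_bool (j = j')"
    and xi: "0 < xi X i"
    and est: "\<And>\<theta> y. \<theta> \<in> carrier_vec k \<Longrightarrow> y \<in> carrier_vec n \<Longrightarrow>
          vec_index (ls_est X y) i = vec_index \<theta> i
            + xi X i / sqrt n * (\<Sum>l<n. q m l * vec_index (y - X *\<^sub>v \<theta>) l)"
    and res: "\<And>\<theta> y. \<theta> \<in> carrier_vec k \<Longrightarrow> y \<in> carrier_vec n \<Longrightarrow>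
          scalar_prod (ls_resid X y) (ls_resid X y)
            = (\<Sum>j<m. (\<Sum>l<n. q j l * vec_index (y - X *\<^sub>v \<theta>) l)\<^sup>2)"
    using least_squares_orthonormal[OF X rank kn i] unfolding m_def by blast
  have dims: "dim_row X = n" "dim_col X = k" using X by auto
  have M: "prob_space M" and Y: "\<And>\<omega>. \<omega> \<in> space M \<Longrightarrow> Y \<omega> \<in> carrier_vec n"
    and Um: "err_coords X \<theta> Y \<in> M \<rightarrow>\<^sub>M PiM {..<n} (\<lambda>_. borel)"
    and law: "distr M (PiM {..<n} (\<lambda>_. borel)) (err_coords X \<theta> Y) = iso_normal n \<sigma>"
    using model unfolding gaussian_linear_model_def dims by auto
  define U where "U = err_coords X \<theta> Y"
  have U: "U \<omega> l = vec_index (Y \<omega> - X *\<^sub>v \<theta>) l" if "l < n" for \<omega> l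
    using that by (simp add: U_def err_coords_def dims)
  let ?B = "\<lambda>I. PiM I (\<lambda>_::nat. borel :: real measure)"
  define Z where "Z u = (\<lambda>j\<in>{..<Suc m}. (\<Sum>l<n. q j l * u l) / \<sigma>)" for u :: "nat \<Rightarrow> real"
  define V where "V z = (sqrt ((\<Sum>j<m. (z j)\<^sup>2) / real m), z m)" for z :: "nat \<Rightarrow> real"
  have [measurable]: "(\<lambda>u. u l) \<in> borel_measurable (?B {..<n})" if "l \<in> {..<n}" for l
    by (rule measurable_component_singleton[OF that])
  have [measurable]: "(\<lambda>z. z j) \<in> borel_measurable (?B {..<Suc m})" if "j \<in> {..<Suc m}" for j
    by (rule measurable_component_singleton[OF that])
  have Zm: "Z \<in> ?B {..<n} \<rightarrow>\<^sub>M ?B {..<Suc m}"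
    unfolding Z_def by (rule measurable_restrict) measurable
  have Vm: "V \<in> ?B {..<Suc m} \<rightarrow>\<^sub>M borel \<Otimes>\<^sub>M borel"
    unfolding V_def by measurable
  have "distr M (?B {..<Suc m}) (\<lambda>\<omega>. Z (U \<omega>)) = distr (distr M (?B {..<n}) U) (?B {..<Suc m}) Z"
    using Um Zm by (subst distr_distr) (auto simp: comp_def U_def)
  also have "\<dots> = PiM {..<Suc m} (\<lambda>_. stdN)"
    unfolding U_def law Z_def by (rule distr_iso_normal_orthonormal[OF _ \<sigma>]) (rule q)
  finally have lawZ: "distr M (?B {..<Suc m}) (\<lambda>\<omega>. Z (U \<omega>)) = PiM {..<Suc m} (\<lambda>_. stdN)" .
  have ZU: "(\<lambda>\<omega>. Z (U \<omega>)) \<in> M \<rightarrow>\<^sub>M ?B {..<Suc m}"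
    using measurable_compose[OF Um Zm] by (simp add: U_def)
  have "distr M (borel \<Otimes>\<^sub>M borel) (\<lambda>\<omega>. V (Z (U \<omega>)))
      = distr (PiM {..<Suc m} (\<lambda>_. stdN)) (borel \<Otimes>\<^sub>M borel) V"
    unfolding lawZ[symmetric] using ZU Vm by (subst distr_distr) (auto simp: comp_def)
  also have "\<dots> = scaled_chi m \<Otimes>\<^sub>M stdN"
    unfolding V_def[abs_def] by (rule scaled_chi_pair)
  finally have lawV: "distr M (borel \<Otimes>\<^sub>M borel) (\<lambda>\<omega>. V (Z (U \<omega>))) = scaled_chi m \<Otimes>\<^sub>M stdN" .
  define r where "r = sqrt (real n) * vec_index \<theta> i / (\<sigma> * xi X i)"
  define e where "e = sqrt (real n) * \<eta>"
  have VZU: "(\<lambda>\<omega>. V (Z (U \<omega>))) \<in> M \<rightarrow>\<^sub>M borel \<Otimes>\<^sub>M borel"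
    by (rule measurable_compose[OF ZU Vm])
  have key: "inverse \<sigma> * (sqrt (real n) / xi X i) * (hard_thr_est X \<eta> i (Y \<omega>) - vec_index \<theta> i)
      = (case V (Z (U \<omega>)) of (s, w) \<Rightarrow> thresholded (ereal r) (s * e) w)" if \<omega>: "\<omega> \<in> space M" for \<omega>
  proof -
    define s where "s = fst (V (Z (U \<omega>)))"
    define w where "w = snd (V (Z (U \<omega>)))"
    define a where "a = \<sigma> * xi X i / sqrt n"
    have n: "0 < real n" using kn by simp
    have a: "0 < a" using n xi \<sigma> by (simp add: a_def)
    have qu: "(\<Sum>l<n. q j l * vec_index (Y \<omega> - X *\<^sub>v \<theta>) l) = \<sigma> * Z (U \<omega>) j" if "j < Suc m" for j
      using that \<sigma> by (simp add: Z_def U)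
    have "sigma_hat X (Y \<omega>) = sqrt ((\<Sum>j<m. (\<sigma> * Z (U \<omega>) j)\<^sup>2) / real m)"
      unfolding sigma_hat_def dims m_def[symmetric] res[OF \<theta> Y[OF \<omega>]] by (simp add: qu)
    also have "(\<Sum>j<m. (\<sigma> * Z (U \<omega>) j)\<^sup>2) / real m = \<sigma>\<^sup>2 * ((\<Sum>j<m. (Z (U \<omega>) j)\<^sup>2) / real m)"
      by (simp add: power_mult_distrib sum_distrib_left)
    also have "sqrt \<dots> = \<sigma> * s"
      using \<sigma> by (simp only: real_sqrt_mult real_sqrt_abs s_def V_def fst_conv abs_of_pos)
    finally have sh: "sigma_hat X (Y \<omega>) = \<sigma> * s" .
    have th: "vec_index \<theta> i = a * r" using n xi \<sigma> by (simp add: a_def r_def)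
    have "vec_index (ls_est X (Y \<omega>)) i = a * r + xi X i / sqrt n * (\<sigma> * w)"
      unfolding est[OF \<theta> Y[OF \<omega>]] th[symmetric] by (simp add: qu w_def V_def)
    also have "\<dots> = a * (w + r)" by (simp add: a_def algebra_simps add_divide_distrib)
    finally have le: "vec_index (ls_est X (Y \<omega>)) i = a * (w + r)" .
    have "sigma_hat X (Y \<omega>) * xi X i * \<eta> = a * (s * e)"
      using n by (simp add: sh a_def e_def)
    then have cond: "\<bar>vec_index (ls_est X (Y \<omega>)) i\<bar> > sigma_hat X (Y \<omega>) * xi X i * \<eta> \<longleftrightarrow> \<bar>w + r\<bar> > s * e"
      using a by (simp add: le abs_mult)
    have "inverse \<sigma> * (sqrt (real n) / xi X i) = inverse a"
      using n xi \<sigma> by (simp add: a_def field_simps)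
    then have "inverse \<sigma> * (sqrt (real n) / xi X i) * (hard_thr_est X \<eta> i (Y \<omega>) - vec_index \<theta> i)
        = inverse a * (a * (w + r) * of_bool (\<bar>w + r\<bar> > s * e) - a * r)"
      unfolding hard_thr_est_def cond by (simp only: le th)
    also have "\<dots> = thresholded (ereal r) (s * e) w"
      using a by (auto simp: thresholded_real field_simps)
    finally show ?thesis by (simp add: s_def w_def split_beta)
  qed
  have "distr M borel (\<lambda>\<omega>. inverse \<sigma> * (sqrt (real n) / xi X i) * (hard_thr_est X \<eta> i (Y \<omega>) - vec_index \<theta> i))
      = distr M borel (\<lambda>\<omega>. case V (Z (U \<omega>)) of (s, w) \<Rightarrow> thresholded (ereal r) (s * e) w)"
    by (rule distr_cong) (use key in auto)
  also have "\<dots> = distr (scaled_chi m \<Otimes>\<^sub>M stdN) borel (\<lambda>(s, w). thresholded (ereal r) (s * e) w)"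
    unfolding lawV[symmetric] using VZU by (subst distr_distr) (auto simp: comp_def)
  finally show ?thesis unfolding ht_law_def r_def e_def m_def .
qed

section \<open>The limit law as a cdf and as a pointmass plus a density\<close>

lemma stdN_singleton: "measure stdN {x} = 0" "emeasure stdN {x} = 0"
proof -
  show "emeasure stdN {x} = 0"
    using absolutely_continuousI_density[of std_normal_density lborel] finite_imp_null_set_lborel[of "{x}"]
    by (auto simp: absolutely_continuous_def)
  then show "measure stdN {x} = 0" by (simp add: measure_def)
qed

lemma Phi_bounds: "0 \<le> Phi z" "Phi z \<le> 1"
proof -
  interpret N: real_distribution stdN by (rule real_dist_normal_dist)
  show "0 \<le> Phi z" "Phi z \<le> 1" by (simp_all add: Phi_def N.prob_le_1)
qed

lemma measurable_Phi [measurable]: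
  assumes [measurable]: "f \<in> borel_measurable M"
  shows "(\<lambda>x. Phi (f x)) \<in> borel_measurable M"
proof -
  interpret N: real_distribution stdN by (rule real_dist_normal_dist)
  have "mono (cdf stdN)" by (auto intro!: monoI N.cdf_nondecreasing)
  then have [measurable]: "cdf stdN \<in> borel_measurable borel" by (rule borel_measurable_mono)
  have "Phi z = (if z = \<infinity> then 1 else if z = -\<infinity> then 0 else cdf stdN (real_of_ereal z))" for z
    by (cases z) (auto simp: Phi_infty Phi_ereal)
  then show ?thesis by simp
qed

lemma Phi_less: "Phi (ereal x) = measure stdN {..<x}"
proof -
  interpret N: real_distribution stdN by (rule real_dist_normal_dist)
  have "measure stdN {..x} = measure stdN ({..<x} \<union> {x})" by (rule arg_cong[where f = "measure stdN"]) auto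
  also have "\<dots> = measure stdN {..<x} + measure stdN {x}"
    by (rule N.finite_measure_Union) auto
  finally show ?thesis by (simp add: Phi_ereal cdf_def stdN_singleton)
qed

text \<open>
  The weight of the pointmass: the probability that the estimator is set to zero.
\<close>

lemma measure_stdN_within:
  assumes "0 \<le> c"
  shows "measure stdN {w. \<not> \<bar>ereal w + \<nu>\<bar> > ereal c} = Phi (- \<nu> + ereal c) - Phi (- \<nu> - ereal c)"
proof -
  interpret N: real_distribution stdN by (rule real_dist_normal_dist)
  show ?thesis
  proof (cases \<nu>)
    case (real r)
    have "{w. \<not> \<bar>ereal w + \<nu>\<bar> > ereal c} = {..- r + c} - {..<- r - c}"
      by (auto simp: real)
    also have "measure stdN \<dots> = measure stdN {..- r + c} - measure stdN {..<- r - c}"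
      using assms by (intro N.finite_measure_Diff) auto
    finally show ?thesis
      using Phi_less[of "- r - c"] by (simp add: real Phi_ereal cdf_def)
  qed auto
qed

lemma Phi_diff_nonneg: "0 \<le> c \<Longrightarrow> 0 \<le> Phi (- \<nu> + ereal c) - Phi (- \<nu> - ereal c)"
  using measure_stdN_within[of c \<nu>] by (metis measure_nonneg)

lemma ht_cdf_nonneg: "0 \<le> ht_cdf \<nu> c x"
  by (simp add: ht_cdf_def Phi_bounds)

text \<open>
  Below \<open>-\<nu> - c\<close> and above \<open>-\<nu> + c\<close> the thresholded variable has the cdf of \<open>w\<close>. In between the mass
  of \<open>[-\<nu> - c, -\<nu> + c]\<close> sits at \<open>-\<nu>\<close>, so the cdf keeps its value at the left end of that interval
  up to \<open>-\<nu>\<close> and then has its value at the right end.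
\<close>

lemma measure_thresholded_le:
  assumes c: "0 \<le> c"
  shows "measure stdN {w. thresholded \<nu> c w \<le> x} = ht_cdf \<nu> c x"
proof -
  interpret N: real_distribution stdN by (rule real_dist_normal_dist)
  have inf: "measure stdN {w. w \<le> x} = Phi (ereal x)" by (simp add: Phi_ereal cdf_def atMost_def)
  show ?thesis
  proof (cases \<nu>)
    case (real r)
    consider "x + r < - c" | "- c \<le> x + r" "x + r < 0" | "0 \<le> x + r" "x + r \<le> c" | "c < x + r" by linarith
    then show ?thesis
    proof cases
      case 1
      then have "{w. thresholded \<nu> c w \<le> x} = {w. w \<le> x}"
        using c by (auto simp: real thresholded_real)
      with 1 c inf show ?thesis by (auto simp: ht_cdf_def real)
    next
      case 2
      then have "{w. thresholded \<nu> c w \<le> x} = {..<- r - c}"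
        using c by (auto simp: real thresholded_real split: if_splits)
      with 2 c show ?thesis by (auto simp: ht_cdf_def real simp flip: Phi_less)
    next
      case 3
      then have "{w. thresholded \<nu> c w \<le> x} = {w. w \<le> - r + c}"
        using c by (auto simp: real thresholded_real split: if_splits)
      with 3 c show ?thesis by (auto simp: ht_cdf_def real Phi_ereal cdf_def atMost_def)
    next
      case 4
      then have "{w. thresholded \<nu> c w \<le> x} = {w. w \<le> x}"
        using c by (auto simp: real thresholded_real split: if_splits)
      with 4 c inf show ?thesis by (auto simp: ht_cdf_def real)
    qed
  qed (use inf in \<open>auto simp: thresholded_infinite ht_cdf_def\<close>)
qed

lemma ht_cdf_bound: "\<bar>ht_cdf \<nu> c x\<bar> \<le> 3"
  using Phi_bounds[of "ereal x"] Phi_bounds[of "- \<nu> + ereal c"] Phi_bounds[of "- \<nu> - ereal c"]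
  by (auto simp: ht_cdf_def of_bool_def)

lemma measurable_ht_cdf [measurable]: "(\<lambda>c. ht_cdf \<nu> c x) \<in> borel_measurable borel"
  unfolding ht_cdf_def of_bool_def by measurable

context
  fixes \<mu> :: "real measure" and e :: real
  assumes \<mu>: "real_distribution \<mu>" and nonneg: "AE s in \<mu>. 0 \<le> s" and e: "0 \<le> e"
begin

interpretation M: real_distribution \<mu> by (rule \<mu>)
interpretation N: real_distribution stdN by (rule real_dist_normal_dist)
interpretation MN: pair_prob_space \<mu> stdN by unfold_locales

lemma AE_threshold_nonneg: "AE s in \<mu>. 0 \<le> s * e"
  by (rule eventually_mono[OF nonneg]) (simp add: e)

lemma emeasure_ht_law:
  assumes [measurable]: "A \<in> sets borel"
  shows "emeasure (ht_law \<mu> \<nu> e) A = (\<integral>\<^sup>+ s. emeasure stdN {w. thresholded \<nu> (s * e) w \<in> A} \<partial>\<mu>)"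
proof -
  let ?B = "{x \<in> space (\<mu> \<Otimes>\<^sub>M stdN). thresholded \<nu> (fst x * e) (snd x) \<in> A}"
  have B: "?B \<in> sets (\<mu> \<Otimes>\<^sub>M stdN)" by measurable
  have "emeasure (ht_law \<mu> \<nu> e) A = emeasure (\<mu> \<Otimes>\<^sub>M stdN) ?B"
    unfolding ht_law_def by (subst emeasure_distr) (auto simp: split_beta' intro!: arg_cong2[where f = emeasure])
  also have "\<dots> = (\<integral>\<^sup>+ s. emeasure stdN (Pair s -` ?B) \<partial>\<mu>)"
    by (rule N.emeasure_pair_measure_alt[OF B])
  also have "\<dots> = (\<integral>\<^sup>+ s. emeasure stdN {w. thresholded \<nu> (s * e) w \<in> A} \<partial>\<mu>)"
    by (intro nn_integral_cong arg_cong2[where f = emeasure]) (auto simp: space_pair_measure)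
  finally show ?thesis .
qed

lemma cdf_ht_law: "cdf (ht_law \<mu> \<nu> e) x = (LINT s|\<mu>. ht_cdf \<nu> (s * e) x)"
proof -
  interpret L: real_distribution "ht_law \<mu> \<nu> e" by (rule real_distribution_ht_law[OF \<mu>])
  have "ennreal (cdf (ht_law \<mu> \<nu> e) x) = (\<integral>\<^sup>+ s. emeasure stdN {w. thresholded \<nu> (s * e) w \<le> x} \<partial>\<mu>)"
    using emeasure_ht_law[of "{..x}" \<nu>] by (simp add: cdf_def L.emeasure_eq_measure)
  also have "\<dots> = (\<integral>\<^sup>+ s. ennreal (ht_cdf \<nu> (s * e) x) \<partial>\<mu>)"
    by (rule nn_integral_cong_AE, rule eventually_mono[OF AE_threshold_nonneg])
       (simp add: N.emeasure_eq_measure measure_thresholded_le)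
  also have "\<dots> = ennreal (LINT s|\<mu>. ht_cdf \<nu> (s * e) x)"
  proof (rule nn_integral_eq_integral)
    show "integrable \<mu> (\<lambda>s. ht_cdf \<nu> (s * e) x)"
      by (rule M.integrable_const_bound[of _ 3]) (auto simp: ht_cdf_bound)
    show "AE s in \<mu>. 0 \<le> ht_cdf \<nu> (s * e) x"
      by (simp add: ht_cdf_nonneg)
  qed
  finally have *: "ennreal (cdf (ht_law \<mu> \<nu> e) x) = ennreal (LINT s|\<mu>. ht_cdf \<nu> (s * e) x)" .
  have "0 \<le> (LINT s|\<mu>. ht_cdf \<nu> (s * e) x)"
    by (simp add: ht_cdf_nonneg)
  with * show ?thesis by (simp add: cdf_def)
qed

text \<open>
  A Borel set is hit either by \<open>w\<close> when it passes the threshold or by \<open>-\<nu>\<close> when it does not.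
  Integrating both parts over the threshold and exchanging the integrals in the first gives the
  set function that \<open>atom_plus_density\<close> extends; as it agrees with a measure, the extension is
  that measure.
\<close>

lemma atom_plus_density_ht_law:
  "atom_plus_density (LINT s|\<mu>. Phi (- \<nu> + ereal (s * e)) - Phi (- \<nu> - ereal (s * e))) (- \<nu>)
     (\<lambda>x. std_normal_density x * (LINT s|\<mu>. of_bool (\<bar>ereal x + \<nu>\<bar> > ereal (s * e)))) = ht_law \<mu> \<nu> e"
proof -
  let ?w = "LINT s|\<mu>. Phi (- \<nu> + ereal (s * e)) - Phi (- \<nu> - ereal (s * e))"
  let ?g = "\<lambda>x. std_normal_density x * (LINT s|\<mu>. of_bool (\<bar>ereal x + \<nu>\<bar> > ereal (s * e)))"
  have parts: "emeasure stdN {w. thresholded \<nu> c w \<in> A}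
      = (\<integral>\<^sup>+x\<in>A. ennreal (std_normal_density x) * of_bool (\<bar>ereal x + \<nu>\<bar> > ereal c) \<partial>lborel)
        + ennreal (Phi (- \<nu> + ereal c) - Phi (- \<nu> - ereal c)) * indicator (ereal ` A) (- \<nu>)"
    if c: "0 \<le> c" and [measurable]: "A \<in> sets borel" for c A
  proof -
    let ?I = "{w \<in> A. \<bar>ereal w + \<nu>\<bar> > ereal c}" and ?J = "{w. \<not> \<bar>ereal w + \<nu>\<bar> > ereal c}"
    have IJ: "?I \<in> sets stdN" "?J \<in> sets stdN" by auto
    have at: "real_of_ereal (- \<nu>) \<in> A \<longleftrightarrow> - \<nu> \<in> ereal ` A" if "?J \<noteq> {}"
      using that by (cases \<nu>) auto
    have "emeasure stdN {w. thresholded \<nu> c w \<in> A}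
        = emeasure stdN (?I \<union> (if - \<nu> \<in> ereal ` A then ?J else {}))"
      by (rule arg_cong[where f = "emeasure stdN"])
         (use at in \<open>auto simp: thresholded_def split: if_splits\<close>)
    also have "\<dots> = emeasure stdN ?I + emeasure stdN (if - \<nu> \<in> ereal ` A then ?J else {})"
      by (rule plus_emeasure[symmetric]) (use IJ in auto)
    also have "emeasure stdN (if - \<nu> \<in> ereal ` A then ?J else {})
        = ennreal (Phi (- \<nu> + ereal c) - Phi (- \<nu> - ereal c)) * indicator (ereal ` A) (- \<nu>)"
      using measure_stdN_within[OF c, of \<nu>] by (simp add: N.emeasure_eq_measure indicator_def)
    also have "emeasure stdN ?I = (\<integral>\<^sup>+x\<in>A. ennreal (std_normal_density x) * of_bool (\<bar>ereal x + \<nu>\<bar> > ereal c) \<partial>lborel)"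
      by (subst emeasure_density) (auto intro!: nn_integral_cong simp: indicator_def)
    finally show ?thesis .
  qed
  have w: "(\<integral>\<^sup>+ s. ennreal (Phi (- \<nu> + ereal (s * e)) - Phi (- \<nu> - ereal (s * e))) \<partial>\<mu>) = ennreal ?w"
  proof (rule nn_integral_eq_integral)
    show "integrable \<mu> (\<lambda>s. Phi (- \<nu> + ereal (s * e)) - Phi (- \<nu> - ereal (s * e)))"
    proof (rule M.integrable_const_bound[of _ 1])
      have "\<bar>Phi a - Phi b\<bar> \<le> 1" for a b
        using Phi_bounds[of a] Phi_bounds[of b] by linarith
      then show "AE s in \<mu>. norm (Phi (- \<nu> + ereal (s * e)) - Phi (- \<nu> - ereal (s * e))) \<le> 1" by simp
    qed measurable
    show "AE s in \<mu>. 0 \<le> Phi (- \<nu> + ereal (s * e)) - Phi (- \<nu> - ereal (s * e))"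
      by (rule eventually_mono[OF AE_threshold_nonneg]) (simp only: Phi_diff_nonneg)
  qed
  have g: "(\<integral>\<^sup>+ s. of_bool (\<bar>ereal x + \<nu>\<bar> > ereal (s * e)) \<partial>\<mu>)
      = ennreal (LINT s|\<mu>. of_bool (\<bar>ereal x + \<nu>\<bar> > ereal (s * e)))" for x
  proof -
    have "(\<integral>\<^sup>+ s. ennreal (of_bool (\<bar>ereal x + \<nu>\<bar> > ereal (s * e))) \<partial>\<mu>)
      = ennreal (LINT s|\<mu>. of_bool (\<bar>ereal x + \<nu>\<bar> > ereal (s * e)))"
      by (intro nn_integral_eq_integral M.integrable_const_bound[of _ 1]) auto
    then show ?thesis by (simp add: of_bool_def if_distrib[of ennreal] cong: if_cong)
  qed
  have "emeasure (ht_law \<mu> \<nu> e) A = ennreal ?w * indicator (ereal ` A) (- \<nu>) + (\<integral>\<^sup>+x\<in>A. ennreal (?g x) \<partial>lborel)"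
    if A [measurable]: "A \<in> sets borel" for A
  proof -
    have "emeasure (ht_law \<mu> \<nu> e) A
       = (\<integral>\<^sup>+ s. (\<integral>\<^sup>+x\<in>A. ennreal (std_normal_density x) * of_bool (\<bar>ereal x + \<nu>\<bar> > ereal (s * e)) \<partial>lborel)
          + ennreal (Phi (- \<nu> + ereal (s * e)) - Phi (- \<nu> - ereal (s * e))) * indicator (ereal ` A) (- \<nu>) \<partial>\<mu>)"
      unfolding emeasure_ht_law[OF A]
      by (rule nn_integral_cong_AE, rule eventually_mono[OF AE_threshold_nonneg]) (simp only: parts A)
    also have "\<dots> = (\<integral>\<^sup>+ s. (\<integral>\<^sup>+x\<in>A. ennreal (std_normal_density x) * of_bool (\<bar>ereal x + \<nu>\<bar> > ereal (s * e)) \<partial>lborel) \<partial>\<mu>)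
          + ennreal ?w * indicator (ereal ` A) (- \<nu>)"
      by (subst nn_integral_add) (auto simp: nn_integral_multc w)
    also have "(\<integral>\<^sup>+ s. (\<integral>\<^sup>+x\<in>A. ennreal (std_normal_density x) * of_bool (\<bar>ereal x + \<nu>\<bar> > ereal (s * e)) \<partial>lborel) \<partial>\<mu>)
       = (\<integral>\<^sup>+ x. (\<integral>\<^sup>+ s. ennreal (std_normal_density x) * of_bool (\<bar>ereal x + \<nu>\<bar> > ereal (s * e)) * indicator A x \<partial>\<mu>) \<partial>lborel)"
    proof -
      interpret PL: pair_sigma_finite \<mu> lborel by unfold_locales
      show ?thesis by (rule PL.Fubini'[symmetric]) measurable
    qed
    also have "\<dots> = (\<integral>\<^sup>+x\<in>A. ennreal (?g x) \<partial>lborel)"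
      by (rule nn_integral_cong)
         (simp add: nn_integral_cmult nn_integral_multc g ennreal_mult mult.assoc)
    finally show ?thesis by (simp add: add.commute)
  qed
  then have "atom_plus_density ?w (- \<nu>) ?g = measure_of UNIV (sets borel) (emeasure (ht_law \<mu> \<nu> e))"
    unfolding atom_plus_density_def
    by (intro measure_of_eq) (auto simp: sets.sigma_sets_eq[of borel, simplified])
  also have "\<dots> = ht_law \<mu> \<nu> e"
    using measure_of_of_measure[of "ht_law \<mu> \<nu> e"] by (simp add: ht_law_def)
  finally show ?thesis .
qed

lemma ht_law_std_normal:
  assumes "\<bar>\<nu>\<bar> = \<infinity> \<or> e = 0"
  shows "ht_law \<mu> \<nu> e = stdN"
proof -
  have "thresholded \<nu> (s * e) w = w" for s w
    using assms by (cases \<nu>) (auto simp: thresholded_def)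
  then have "emeasure (ht_law \<mu> \<nu> e) A = emeasure stdN A" if "A \<in> sets borel" for A
    using that M.emeasure_space_1 by (simp add: emeasure_ht_law)
  then show ?thesis by (intro measure_eqI) auto
qed

end

text \<open>
  A deterministic threshold is the mixture over the pointmass at 1.
\<close>

lemma ht_measure_eq_ht_law:
  assumes e: "0 \<le> e"
  shows "ht_measure \<nu> e = ht_law (return borel 1) \<nu> e"
proof -
  have R: "real_distribution (return borel (1::real))"
    unfolding real_distribution_def real_distribution_axioms_def by (simp add: prob_space_return)
  have "AE s in return borel (1::real). 0 \<le> s" by (subst AE_return) auto
  from atom_plus_density_ht_law[OF R this e, of \<nu>] show ?thesis
    by (simp add: ht_measure_def integral_return of_bool_def)
qed

lemma cdf_ht_measure:
  assumes e: "0 \<le> e"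
  shows "cdf (ht_measure \<nu> e) = ht_cdf \<nu> e"
proof
  fix x
  have R: "real_distribution (return borel (1::real))"
    unfolding real_distribution_def real_distribution_axioms_def by (simp add: prob_space_return)
  have "AE s in return borel (1::real). 0 \<le> s" by (subst AE_return) auto
  from cdf_ht_law[OF R this e, of \<nu> x] show "cdf (ht_measure \<nu> e) x = ht_cdf \<nu> e x"
    by (simp add: ht_measure_eq_ht_law[OF e] integral_return)
qed

lemma ht_measure_mix_eq_ht_law:
  assumes m: "0 < m" and e: "0 \<le> e"
  shows "ht_measure_mix m \<nu> e = ht_law (scaled_chi m) \<nu> e"
  unfolding ht_measure_mix_def of_bool_def
  using atom_plus_density_ht_law[OF real_distribution_scaled_chi AE_scaled_chi_nonneg e, of m \<nu>]
  by (subst (1 2) LBINT_rho[OF m]) (auto simp: of_bool_def)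

lemma cdf_ht_measure_mix:
  assumes m: "0 < m" and e: "0 \<le> e"
  shows "cdf (ht_measure_mix m \<nu> e) = ht_cdf_mix m \<nu> e"
  using cdf_ht_law[OF real_distribution_scaled_chi AE_scaled_chi_nonneg e, of m \<nu>]
  by (simp add: fun_eq_iff ht_measure_mix_eq_ht_law[OF m e] ht_cdf_mix_def LBINT_rho[OF m])

section \<open>Weak convergence\<close>

text \<open>
  Skorohod's representation makes the thresholds converge pointwise on one probability space, to
  which an independent standard normal \<open>w\<close> is adjoined. There the thresholded variables converge
  almost surely, and dominated convergence applies to the continuous test functions that
  characterise weak convergence.
\<close>

theorem weak_conv_ht_law:
  assumes \<mu>s: "\<And>n. real_distribution (\<mu>s n)" and \<mu>: "real_distribution \<mu>"
    and conv: "weak_conv_m \<mu>s \<mu>"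
    and r: "(\<lambda>n. ereal (r n)) \<longlonglongrightarrow> \<nu>" and es: "es \<longlonglongrightarrow> e"
  shows "weak_conv_m (\<lambda>n. ht_law (\<mu>s n) (ereal (r n)) (es n)) (ht_law \<mu> \<nu> e)"
proof (rule integral_cts_step_conv_imp_weak_conv)
  show "real_distribution (ht_law (\<mu>s n) (ereal (r n)) (es n))" for n
    by (rule real_distribution_ht_law[OF \<mu>s])
  show "real_distribution (ht_law \<mu> \<nu> e)"
    by (rule real_distribution_ht_law[OF \<mu>])
  fix x y :: real assume xy: "x < y"
  obtain \<Omega> :: "real measure" and S :: "nat \<Rightarrow> real \<Rightarrow> real" and T :: "real \<Rightarrow> real" where
    \<Omega>: "prob_space \<Omega>" and S [measurable]: "\<And>n. S n \<in> borel_measurable \<Omega>" and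
    lawS: "\<And>n. distr \<Omega> borel (S n) = \<mu>s n" and T: "T \<in> measurable \<Omega> lborel" and
    lawT: "distr \<Omega> borel T = \<mu>" and ST: "\<And>\<omega>. \<omega> \<in> space \<Omega> \<Longrightarrow> (\<lambda>n. S n \<omega>) \<longlonglongrightarrow> T \<omega>"
    using Skorohod[OF \<mu>s \<mu> conv] by blast
  have [measurable]: "T \<in> borel_measurable \<Omega>" using T by simp
  interpret \<Omega>: prob_space \<Omega> by fact
  interpret N: real_distribution stdN by (rule real_dist_normal_dist)
  interpret P: pair_prob_space \<Omega> stdN by unfold_locales
  define f where "f = cts_step x y"
  have f_cont: "isCont f a" for a
    using uniformly_continuous_imp_continuous[OF cts_step_uniformly_continuous[OF xy]]
    by (simp add: f_def continuous_on_eq_continuous_at)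
  have fm [measurable]: "f \<in> borel_measurable borel"
    by (intro borel_measurable_continuous_onI continuous_at_imp_continuous_on ballI f_cont)
  have f_bd: "norm (f a) \<le> 1" for a
    using xy by (auto simp: f_def cts_step_def)
  have lift: "(LINT z|ht_law (distr \<Omega> borel g) \<kappa> c. f z) = (LINT (\<omega>, w)|(\<Omega> \<Otimes>\<^sub>M stdN). f (thresholded \<kappa> (g \<omega> * c) w))"
    if [measurable]: "g \<in> borel_measurable \<Omega>" for g \<kappa> c
  proof -
    have "distr \<Omega> borel g \<Otimes>\<^sub>M stdN = distr \<Omega> borel g \<Otimes>\<^sub>M distr stdN borel (\<lambda>w. w)"
      by (simp add: distr_id2)
    also have "\<dots> = distr (\<Omega> \<Otimes>\<^sub>M stdN) (borel \<Otimes>\<^sub>M borel) (\<lambda>(\<omega>, w). (g \<omega>, w))"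
      by (rule pair_measure_distr)
         (auto intro!: prob_space_imp_sigma_finite N.prob_space_distr)
    finally have *: "distr \<Omega> borel g \<Otimes>\<^sub>M stdN = distr (\<Omega> \<Otimes>\<^sub>M stdN) (borel \<Otimes>\<^sub>M borel) (\<lambda>(\<omega>, w). (g \<omega>, w))" .
    have "ht_law (distr \<Omega> borel g) \<kappa> c = distr (\<Omega> \<Otimes>\<^sub>M stdN) borel (\<lambda>(\<omega>, w). thresholded \<kappa> (g \<omega> * c) w)"
      unfolding ht_law_def * by (subst distr_distr) (auto simp: comp_def split_beta')
    then show ?thesis by (simp add: integral_distr split_beta')
  qed
  have lim: "AE (\<omega>, w) in \<Omega> \<Otimes>\<^sub>M stdN. (\<lambda>n. thresholded (ereal (r n)) (S n \<omega> * es n) w) \<longlonglongrightarrow> thresholded \<nu> (T \<omega> * e) w"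
  proof -
    \<comment> \<open>The discontinuities of the thresholded variable: two values of \<open>w\<close> for each \<open>\<omega>\<close>.\<close>
    have "AE z in \<Omega> \<Otimes>\<^sub>M stdN. \<bar>ereal (snd z) + \<nu>\<bar> \<noteq> ereal (T (fst z) * e)"
    proof (rule P.AE_pair_measure)
      show "{z \<in> space (\<Omega> \<Otimes>\<^sub>M stdN). \<bar>ereal (snd z) + \<nu>\<bar> \<noteq> ereal (T (fst z) * e)} \<in> sets (\<Omega> \<Otimes>\<^sub>M stdN)"
        by measurable
      have "AE w in stdN. \<bar>ereal w + \<nu>\<bar> \<noteq> ereal c" for c
      proof -
        have "{- real_of_ereal \<nu> + c, - real_of_ereal \<nu> - c} \<in> null_sets stdN"
          using absolutely_continuousI_density[of std_normal_density lborel]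
            finite_imp_null_set_lborel[of "{- real_of_ereal \<nu> + c, - real_of_ereal \<nu> - c}"]
          by (auto simp: absolutely_continuous_def)
        then show ?thesis
          by (rule AE_I') (cases \<nu>; auto simp: abs_if split: if_splits)
      qed
      then show "AE \<omega> in \<Omega>. AE w in stdN. \<bar>ereal (snd (\<omega>, w)) + \<nu>\<bar> \<noteq> ereal (T (fst (\<omega>, w)) * e)"
        by simp
    qed
    then show ?thesis
    proof (rule AE_mp, intro AE_I2 impI)
      fix z assume z: "z \<in> space (\<Omega> \<Otimes>\<^sub>M stdN)"
        and ne: "\<bar>ereal (snd z) + \<nu>\<bar> \<noteq> ereal (T (fst z) * e)"
      obtain \<omega> w where zz: "z = (\<omega>, w)" by (cases z)
      have \<omega>: "\<omega> \<in> space \<Omega>" using z by (simp add: zz space_pair_measure)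
      have c: "(\<lambda>n. ereal (S n \<omega> * es n)) \<longlonglongrightarrow> ereal (T \<omega> * e)"
        by (intro tendsto_ereal tendsto_mult ST[OF \<omega>] es)
      have "(\<lambda>n. ereal w + ereal (r n)) \<longlonglongrightarrow> ereal w + \<nu>"
        by (rule tendsto_add_ereal_general) (use r in auto)
      then have a: "(\<lambda>n. \<bar>ereal w + ereal (r n)\<bar>) \<longlonglongrightarrow> \<bar>ereal w + \<nu>\<bar>"
        by (rule tendsto_abs_ereal)
      have "(\<lambda>n. thresholded (ereal (r n)) (S n \<omega> * es n) w) \<longlonglongrightarrow> thresholded \<nu> (T \<omega> * e) w"
      proof (cases "\<bar>ereal w + \<nu>\<bar> > ereal (T \<omega> * e)")
        case True
        then obtain d where d: "ereal (T \<omega> * e) < d" "d < \<bar>ereal w + \<nu>\<bar>" using dense by blast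
        have "\<forall>\<^sub>F n in sequentially. ereal (S n \<omega> * es n) < \<bar>ereal w + ereal (r n)\<bar>"
          using order_tendstoD(2)[OF c d(1)] order_tendstoD(1)[OF a d(2)]
          by eventually_elim (rule less_trans)
        then have "\<forall>\<^sub>F n in sequentially. thresholded (ereal (r n)) (S n \<omega> * es n) w = w"
          by eventually_elim (simp only: thresholded_def if_True)
        then show ?thesis using True by (simp add: thresholded_def tendsto_eventually)
      next
        case False
        with ne have lt: "\<bar>ereal w + \<nu>\<bar> < ereal (T \<omega> * e)" by (simp add: zz)
        then obtain d where d: "\<bar>ereal w + \<nu>\<bar> < d" "d < ereal (T \<omega> * e)" using dense by blast
        obtain v where v: "\<nu> = ereal v" using lt by (cases \<nu>) auto
        have "\<forall>\<^sub>F n in sequentially. \<bar>ereal w + ereal (r n)\<bar> < ereal (S n \<omega> * es n)"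
          using order_tendstoD(2)[OF a d(1)] order_tendstoD(1)[OF c d(2)]
          by eventually_elim (rule less_trans)
        then have ev: "\<forall>\<^sub>F n in sequentially. - r n = thresholded (ereal (r n)) (S n \<omega> * es n) w"
          by eventually_elim (auto simp: thresholded_def)
        have "(\<lambda>n. - r n) \<longlonglongrightarrow> - v"
          using r by (intro tendsto_minus) (simp add: v)
        then have "(\<lambda>n. thresholded (ereal (r n)) (S n \<omega> * es n) w) \<longlonglongrightarrow> - v"
          by (rule Lim_transform_eventually) (rule ev)
        then show ?thesis using False by (simp add: thresholded_def v)
      qed
      then show "case z of (\<omega>, w) \<Rightarrow> (\<lambda>n. thresholded (ereal (r n)) (S n \<omega> * es n) w) \<longlonglongrightarrow> thresholded \<nu> (T \<omega> * e) w"
        by (simp add: zz)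
    qed
  qed
  have "(\<lambda>n. LINT z|(\<Omega> \<Otimes>\<^sub>M stdN). f (thresholded (ereal (r n)) (S n (fst z) * es n) (snd z)))
      \<longlonglongrightarrow> (LINT z|(\<Omega> \<Otimes>\<^sub>M stdN). f (thresholded \<nu> (T (fst z) * e) (snd z)))"
  proof (rule integral_dominated_convergence[where w = "\<lambda>_. 1"])
    show "AE z in \<Omega> \<Otimes>\<^sub>M stdN. (\<lambda>n. f (thresholded (ereal (r n)) (S n (fst z) * es n) (snd z)))
        \<longlonglongrightarrow> f (thresholded \<nu> (T (fst z) * e) (snd z))"
      using lim by (rule eventually_mono) (auto intro: isCont_tendsto_compose[OF f_cont])
  qed (use f_bd in auto)
  then show "(\<lambda>n. integral\<^sup>L (ht_law (\<mu>s n) (ereal (r n)) (es n)) (cts_step x y))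
      \<longlonglongrightarrow> integral\<^sup>L (ht_law \<mu> \<nu> e) (cts_step x y)"
    using lift[OF S] lift[of T] by (simp add: lawS lawT f_def split_beta')
qed

text \<open>
  Markov's inequality, in the form of a pointwise bound on the indicator of the tail beyond \<open>x\<close> on
  the side away from \<open>a\<close>.
\<close>

lemma weak_conv_return:
  fixes \<mu>s :: "nat \<Rightarrow> real measure"
  assumes \<mu>s: "\<And>n. real_distribution (\<mu>s n)"
    and int: "\<forall>\<^sub>F n in sequentially. integrable (\<mu>s n) (\<lambda>s. (s - a)\<^sup>2)"
    and lim: "(\<lambda>n. LINT s|\<mu>s n. (s - a)\<^sup>2) \<longlonglongrightarrow> 0"
  shows "weak_conv_m \<mu>s (return borel a)"
  unfolding weak_conv_m_def weak_conv_def
proof (intro allI impI)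
  fix x assume cont: "isCont (cdf (return borel a)) x"
  have R: "real_distribution (return borel a)"
    unfolding real_distribution_def real_distribution_axioms_def by (simp add: prob_space_return)
  have cdf_ret: "cdf (return borel a) x = of_bool (a \<le> x)"
    by (simp add: cdf_def measure_return indicator_def)
  have "x \<noteq> a"
  proof
    assume "x = a"
    interpret R: real_distribution "return borel a" by (rule R)
    have "measure (return borel a) {a} = 0" using cont R.isCont_cdf \<open>x = a\<close> by simp
    then show False by (simp add: measure_return)
  qed
  have bound: "\<bar>cdf (\<mu>s n) x - of_bool (a \<le> x)\<bar> \<le> (LINT s|\<mu>s n. (s - a)\<^sup>2) / (x - a)\<^sup>2"
    if int: "integrable (\<mu>s n) (\<lambda>s. (s - a)\<^sup>2)" for n
  proof -
    interpret M: real_distribution "\<mu>s n" by (rule \<mu>s)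
    define B where "B = (if x < a then {..x} else {x<..})"
    have B: "B \<in> sets borel" by (simp add: B_def)
    have "\<bar>cdf (\<mu>s n) x - of_bool (a \<le> x)\<bar> = measure (\<mu>s n) B"
    proof (cases "x < a")
      case True then show ?thesis by (simp add: B_def cdf_def)
    next
      case False
      have "{x<..} = space (\<mu>s n) - {..x}" by auto
      then have "measure (\<mu>s n) {x<..} = 1 - cdf (\<mu>s n) x"
        using M.prob_compl[of "{..x}"] by (simp add: cdf_def)
      with False show ?thesis by (simp add: B_def M.cdf_bounded_prob)
    qed
    also have "\<dots> = (LINT s|\<mu>s n. indicator B s)" using B by simp
    also have "\<dots> \<le> (LINT s|\<mu>s n. (s - a)\<^sup>2 / (x - a)\<^sup>2)"
    proof (rule integral_mono)
      show "integrable (\<mu>s n) (indicator B :: real \<Rightarrow> real)"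
        by (rule M.integrable_const_bound[of _ 1]) (use B in auto)
      show "integrable (\<mu>s n) (\<lambda>s. (s - a)\<^sup>2 / (x - a)\<^sup>2)" using int by simp
      fix s
      have "(x - a)\<^sup>2 \<le> (s - a)\<^sup>2" if "s \<in> B"
        using that by (intro abs_le_square_iff[THEN iffD1]) (auto simp: B_def split: if_splits)
      then show "indicator B s \<le> (s - a)\<^sup>2 / (x - a)\<^sup>2"
        using \<open>x \<noteq> a\<close> by (cases "s \<in> B") auto
    qed
    finally show ?thesis by simp
  qed
  have "(\<lambda>n. (LINT s|\<mu>s n. (s - a)\<^sup>2) / (x - a)\<^sup>2) \<longlonglongrightarrow> 0"
    using tendsto_divide[OF lim tendsto_const, of "(x - a)\<^sup>2"] \<open>x \<noteq> a\<close> by simp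
  then have "(\<lambda>n. cdf (\<mu>s n) x - of_bool (a \<le> x)) \<longlonglongrightarrow> 0"
    by (rule Lim_null_comparison[rotated]) (use int in \<open>eventually_elim, simp only: real_norm_def bound\<close>)
  then show "(\<lambda>n. cdf (\<mu>s n) x) \<longlonglongrightarrow> cdf (return borel a) x"
    unfolding cdf_ret by (simp add: LIM_zero_iff)
qed

lemma weak_conv_scaled_chi:
  assumes "filterlim d at_top sequentially"
  shows "weak_conv_m (\<lambda>n. scaled_chi (d n)) (return borel 1)"
proof (rule weak_conv_return)
  have pos: "\<forall>\<^sub>F n in sequentially. 0 < d n"
    using eventually_compose_filterlim[OF eventually_gt_at_top assms] .
  show "real_distribution (scaled_chi (d n))" for n by (rule real_distribution_scaled_chi)
  show "\<forall>\<^sub>F n in sequentially. integrable (scaled_chi (d n)) (\<lambda>s. (s - 1)\<^sup>2)"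
    using pos by eventually_elim (rule scaled_chi_variance)
  have "filterlim (\<lambda>n. real (d n)) at_top sequentially"
    by (rule filterlim_compose[OF filterlim_real_sequentially assms])
  then have lim: "(\<lambda>n. 2 / real (d n)) \<longlonglongrightarrow> 0"
    by (rule real_tendsto_divide_at_top[OF tendsto_const])
  have "\<forall>\<^sub>F n in sequentially. norm (LINT s|scaled_chi (d n). (s - 1)\<^sup>2) \<le> 2 / real (d n)"
    using pos by eventually_elim (simp add: scaled_chi_variance(2) integral_nonneg_AE)
  then show "(\<lambda>n. LINT s|scaled_chi (d n). (s - 1)\<^sup>2) \<longlonglongrightarrow> 0"
    using lim by (rule Lim_null_comparison)
qed

lemma weak_conv_eventually_eq:
  assumes "weak_conv F G" and "\<forall>\<^sub>F n in sequentially. F n = F' n"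
  shows "weak_conv F' G"
  unfolding weak_conv_def
proof (intro allI impI)
  fix x assume "isCont G x"
  then have "(\<lambda>n. F n x) \<longlonglongrightarrow> G x" using assms(1) by (simp add: weak_conv_def)
  then show "(\<lambda>n. F' n x) \<longlonglongrightarrow> G x"
    by (rule Lim_transform_eventually) (use assms(2) in \<open>auto elim: eventually_mono\<close>)
qed

theorem theorem33:
  fixes N i :: nat
    and k :: "nat \<Rightarrow> nat"
    and X :: "nat \<Rightarrow> real mat"
    and P :: "nat \<Rightarrow> real Matrix.vec \<Rightarrow> real \<Rightarrow> 'a measure"
    and Y :: "nat \<Rightarrow> 'a \<Rightarrow> real Matrix.vec"
    and \<eta> :: "nat \<Rightarrow> nat \<Rightarrow> real"
    and \<theta> :: "nat \<Rightarrow> real Matrix.vec"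
    and \<sigma> :: "nat \<Rightarrow> real"
    and e :: real
    and \<nu> :: ereal
    and H :: "nat \<Rightarrow> real \<Rightarrow> real"
  assumes k: "\<And>n. n \<ge> N \<Longrightarrow> 1 \<le> k n \<and> k n < n"
    and X: "\<And>n. n \<ge> N \<Longrightarrow> X n \<in> carrier_mat n (k n)"
    and rank: "\<And>n. n \<ge> N \<Longrightarrow> vec_space.rank n (X n) = k n"
    and model: "\<And>n \<theta> \<sigma>. n \<ge> N \<Longrightarrow> \<theta> \<in> carrier_vec (k n) \<Longrightarrow> 0 < \<sigma> \<Longrightarrow>
                  gaussian_linear_model (P n \<theta> \<sigma>) (X n) \<theta> \<sigma> (Y n)"
    and eta_pos: "\<And>j n. n \<ge> N \<Longrightarrow> j < k n \<Longrightarrow> 0 < \<eta> j n"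
    and xi_bdd: "\<And>j. (\<forall>\<^sub>F n in sequentially. j < k n) \<Longrightarrow>
                  bdd_above ((\<lambda>n. (xi (X n) j)\<^sup>2 / real n) ` {n. n \<ge> N \<and> j < k n})"
    and i: "\<forall>\<^sub>F n in sequentially. i < k n"
    and xi_eta: "(\<lambda>n. xi (X n) i * \<eta> i n) \<longlonglongrightarrow> 0"
    and eta_lim: "(\<lambda>n. sqrt (real n) * \<eta> i n) \<longlonglongrightarrow> e"
    and e: "0 \<le> e"
    and theta: "\<And>n. n \<ge> N \<Longrightarrow> \<theta> n \<in> carrier_vec (k n)"
    and sigma: "\<And>n. n \<ge> N \<Longrightarrow> 0 < \<sigma> n"
    and nu: "(\<lambda>n. ereal (sqrt (real n) * vec_index (\<theta> n) i / (\<sigma> n * xi (X n) i))) \<longlonglongrightarrow> \<nu>"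
    and H: "\<And>n. H n = cdf (distr (P n (\<theta> n) (\<sigma> n)) borel
                  (\<lambda>\<omega>. inverse (\<sigma> n) * (sqrt (real n) / xi (X n) i) *
                        (hard_thr_est (X n) (\<eta> i n) i (Y n \<omega>) - vec_index (\<theta> n) i)))"
  shows "(\<forall>m. (\<forall>\<^sub>F n in sequentially. n - k n = m) \<longrightarrow>
            weak_conv H (ht_cdf_mix m \<nu> e) \<and>
            real_distribution (ht_measure_mix m \<nu> e) \<and>
            cdf (ht_measure_mix m \<nu> e) = ht_cdf_mix m \<nu> e \<and>
            (\<bar>\<nu>\<bar> = \<infinity> \<or> e = 0 \<longrightarrow> ht_measure_mix m \<nu> e = std_normal_distribution)) \<and>
         (filterlim (\<lambda>n. n - k n) at_top sequentially \<longrightarrow>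
            weak_conv H (ht_cdf \<nu> e) \<and>
            real_distribution (ht_measure \<nu> e) \<and>
            cdf (ht_measure \<nu> e) = ht_cdf \<nu> e \<and>
            (\<bar>\<nu>\<bar> = \<infinity> \<or> e = 0 \<longrightarrow> ht_measure \<nu> e = std_normal_distribution))"
proof -
  define \<rho> where "\<rho> n = scaled_chi (n - k n)" for n
  define r where "r n = sqrt (real n) * vec_index (\<theta> n) i / (\<sigma> n * xi (X n) i)" for n
  define es where "es n = sqrt (real n) * \<eta> i n" for n
  have large: "\<forall>\<^sub>F n in sequentially. N \<le> n \<and> i < k n"
    using i eventually_ge_at_top[of N] by eventually_elim simp
  have H_eq: "\<forall>\<^sub>F n in sequentially. cdf (ht_law (\<rho> n) (ereal (r n)) (es n)) = H n"
    using large
  proof eventually_elim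
    case (elim n)
    then have n: "n \<ge> N" "i < k n" by auto
    from k[OF n(1)] have kn: "k n < n" by simp
    show ?case
      using distr_hard_thr_est[OF X[OF n(1)] rank[OF n(1)] kn n(2) theta[OF n(1)] sigma[OF n(1)]
          model[OF n(1) theta[OF n(1)] sigma[OF n(1)]], of "\<eta> i n"] kn
      unfolding H \<rho>_def r_def es_def by simp
  qed
  \<comment> \<open>Both parts are this convergence, with \<open>\<mu>\<close> the scaled chi distribution or the pointmass at 1.\<close>
  have conv: "weak_conv H (cdf (ht_law \<mu> \<nu> e))"
    if "real_distribution \<mu>" "weak_conv_m \<rho> \<mu>" for \<mu>
  proof (rule weak_conv_eventually_eq[OF _ H_eq])
    have "weak_conv_m (\<lambda>n. ht_law (\<rho> n) (ereal (r n)) (es n)) (ht_law \<mu> \<nu> e)"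
    proof (rule weak_conv_ht_law)
      show "real_distribution (\<rho> n)" for n by (simp add: \<rho>_def real_distribution_scaled_chi)
      show "(\<lambda>n. ereal (r n)) \<longlonglongrightarrow> \<nu>" unfolding r_def by (rule nu)
      show "es \<longlonglongrightarrow> e" unfolding es_def by (rule eta_lim)
    qed (rule that)+
    then show "weak_conv (\<lambda>n. cdf (ht_law (\<rho> n) (ereal (r n)) (es n))) (cdf (ht_law \<mu> \<nu> e))"
      by (simp add: weak_conv_m_def)
  qed
  have fixed: "weak_conv H (ht_cdf_mix m \<nu> e) \<and> real_distribution (ht_measure_mix m \<nu> e) \<and>
      cdf (ht_measure_mix m \<nu> e) = ht_cdf_mix m \<nu> e \<and>
      (\<bar>\<nu>\<bar> = \<infinity> \<or> e = 0 \<longrightarrow> ht_measure_mix m \<nu> e = std_normal_distribution)"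
    if m: "\<forall>\<^sub>F n in sequentially. n - k n = m" for m
  proof -
    have "\<forall>\<^sub>F n in sequentially. 0 < m"
      using m large by eventually_elim (use k in force)
    then have m0: "0 < m" by simp
    have ev: "\<forall>\<^sub>F n in sequentially. \<rho> n = scaled_chi m"
      using m by eventually_elim (simp add: \<rho>_def)
    have "weak_conv_m \<rho> (scaled_chi m)"
      unfolding weak_conv_m_def
      by (rule weak_conv_eventually_eq[where F = "\<lambda>_. cdf (scaled_chi m)"])
         (use ev in \<open>auto simp: weak_conv_def elim: eventually_mono\<close>)
    from conv[OF real_distribution_scaled_chi this] show ?thesis
      using real_distribution_ht_law[OF real_distribution_scaled_chi, of m \<nu> e]
        ht_law_std_normal[OF real_distribution_scaled_chi AE_scaled_chi_nonneg e, of \<nu> m]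
      by (simp add: ht_measure_mix_eq_ht_law[OF m0 e, symmetric] cdf_ht_measure_mix[OF m0 e])
  qed
  have growing: "weak_conv H (ht_cdf \<nu> e) \<and> real_distribution (ht_measure \<nu> e) \<and>
      cdf (ht_measure \<nu> e) = ht_cdf \<nu> e \<and>
      (\<bar>\<nu>\<bar> = \<infinity> \<or> e = 0 \<longrightarrow> ht_measure \<nu> e = std_normal_distribution)"
    if m: "filterlim (\<lambda>n. n - k n) at_top sequentially"
  proof -
    have R: "real_distribution (return borel (1::real))"
      unfolding real_distribution_def real_distribution_axioms_def by (simp add: prob_space_return)
    have AE: "AE s in return borel (1::real). 0 \<le> s" by (subst AE_return) auto
    have "weak_conv_m \<rho> (return borel 1)"
      unfolding \<rho>_def by (rule weak_conv_scaled_chi[OF m])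
    from conv[OF R this] show ?thesis
      using real_distribution_ht_law[OF R, of \<nu> e] ht_law_std_normal[OF R AE e, of \<nu>]
      by (simp add: ht_measure_eq_ht_law[OF e, symmetric] cdf_ht_measure[OF e])
  qed
  show ?thesis using fixed growing by blast
qed

end
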